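(* Let $Q:\mathbb{T}^n\to[0,+\infty)$ be real analytic with nonempty zero set $\mathscr{Z}=\{\theta\in\mathbb{T}^n:Q(\theta)=0\}$, and let $\delta>0$. Let $L:=\max_{\mathbb{T}^n}\|\nabla Q\|$, let $d>0$, $N>0$ be constants for which the Łojasiewicz inequality $|Q(\Phi)|\ge d\,\operatorname{dist}(\Phi,\mathscr{Z})^N$ holds for all $\Phi\in\mathbb{T}^n$, and set $\tilde N:=\max\{2,N\}$, $$\sigma_1:=\frac{2\pi\sqrt n+L}{2}\max\left\{2^{\tilde N+1}(2\pi\sqrt n)^{\tilde N-2},\ \frac{2^{\tilde N}(2\pi\sqrt n)^{\tilde N-N}}{d}\right\},\qquad \sigma_2:=\frac{(2\pi\sqrt n+L)\,\sigma_1^N}{2d}.$$ Let $V$ be the value function and $\{V_i\}_{i\in\mathbb{N}}$ the value iteration sequence (defined in the context). Then for any $\varepsilon>0$ and every $i\in\mathbb{N}$ with $$i>\frac{2\pi\sqrt n\,\sigma_2}{\delta\left(\frac{-L+\sqrt{L^2+8\varepsilon}}{2}\right)^{\tilde NN}}$$ we have $$|V_i(\theta)-V(\theta)|<\varepsilon\qquad\text{for all }\theta\in\mathbb{T}^n .$$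
   Context: $\mathbb{T}=\mathbb{R}/2\pi\mathbb{Z}$; distances on $\mathbb{T}^n$ are (quotient) Euclidean distances on the flat torus. $H^1_{loc}([0,+\infty);\mathbb{T}^n)$ is the set of maps $\Phi:[0,+\infty)\to\mathbb{T}^n$ belonging to $H^1((0,T);\mathbb{T}^n)$ for every $T>0$ (continuous, weakly differentiable with $\dot\Phi\in L^2((0,T);\mathbb{R}^n)$). For $\theta\in\mathbb{T}^n$, $$\mathscr{A}_\theta=\left\{\Phi\in H^1_{loc}([0,+\infty);\mathbb{T}^n)\ :\ \Phi(0)=\theta,\ \tfrac12\|\dot\Phi\|^2+Q(\Phi)\in L^1(0,+\infty)\right\}.$$ The value function is $$V(\theta)=\inf_{\Phi\in\mathscr{A}_\theta}\int_0^\infty\tfrac12\|\dot\Phi\|^2+Q(\Phi)\,dt .$$ The value iteration sequence is defined by the initial guess $$V_0(\theta):=\tfrac12\operatorname{dist}(\theta,\mathscr{Z})^2+\tfrac L2\operatorname{dist}(\theta,\mathscr{Z})$$ and, for $i\in\mathbb{N}$ and $\theta\in\mathbb{T}^n$, $$V_{i+1}(\theta):=\inf_{\Phi\in\mathscr{A}_\theta}\left\{\int_0^\delta\tfrac12\|\dot\Phi\|^2+Q(\Phi)\,ds+V_i(\Phi(\delta))\right\}.$$ *)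

theory Defs
  imports "HOL-Analysis.Analysis"
begin

section \<open>The flat torus\<close>

quotient_type circle = real / "\<lambda>x y. \<exists>k::int. x - y = 2 * pi * of_int k"
  morphisms rep_circle circle_of
proof (rule equivpI)
  show "reflp (\<lambda>x y. \<exists>k::int. x - y = 2 * pi * of_int k)"
    by (auto intro!: reflpI exI[of _ 0])
  show "symp (\<lambda>x y. \<exists>k::int. x - y = 2 * pi * of_int k)"
  proof (rule sympI)
    fix x y :: real
    assume "\<exists>k::int. x - y = 2 * pi * of_int k"
    then obtain k :: int where "x - y = 2 * pi * of_int k" by blast
    then have "y - x = 2 * pi * of_int (- k)" by simp
    then show "\<exists>k::int. y - x = 2 * pi * of_int k" by blast
  qed
  show "transp (\<lambda>x y. \<exists>k::int. x - y = 2 * pi * of_int k)"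
  proof (rule transpI)
    fix x y z :: real
    assume "\<exists>k::int. x - y = 2 * pi * of_int k" "\<exists>k::int. y - z = 2 * pi * of_int k"
    then obtain k l :: int where "x - y = 2 * pi * of_int k" "y - z = 2 * pi * of_int l" by blast
    then have "x - z = 2 * pi * of_int (k + l)" by (simp add: distrib_left)
    then show "\<exists>k::int. x - z = 2 * pi * of_int k" by blast
  qed
qed

lemma circle_of_eq_iff: "circle_of x = circle_of y \<longleftrightarrow> (\<exists>k::int. x - y = 2 * pi * of_int k)"
  by (rule circle.abs_eq_iff)

lemma circle_of_surj: "\<exists>x. circle_of x = p"
  by (metis Quotient_circle Quotient_abs_rep)

instantiation circle :: metric_space
begin

definition dist_circle :: "circle \<Rightarrow> circle \<Rightarrow> real" where
  "dist_circle p q = Inf {dist x y | x y. circle_of x = p \<and> circle_of y = q}"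

definition uniformity_circle :: "(circle \<times> circle) filter" where
  "uniformity_circle = (INF e\<in>{0 <..}. principal {(x, y). dist x y < e})"

definition open_circle :: "circle set \<Rightarrow> bool" where
  "open_circle U \<longleftrightarrow> (\<forall>x\<in>U. eventually (\<lambda>(x', y). x' = x \<longrightarrow> y \<in> U) uniformity)"

lemma dist_circle_le: "dist (circle_of x) (circle_of y) \<le> \<bar>x - y\<bar>"
  unfolding dist_circle_def
  by (rule cInf_lower) (auto simp: dist_real_def intro!: bdd_belowI[of _ 0])

lemma dist_circle_attained:
  "\<exists>x. circle_of x = p \<and> dist p (circle_of y) = \<bar>x - y\<bar>"
proof -
  obtain x0 where x0: "circle_of x0 = p" using circle_of_surj by blast
  define z where "z = (x0 - y) / (2 * pi)"
  define x where "x = x0 - 2 * pi * of_int (round z)"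
  have x: "circle_of x = p"
    unfolding x0[symmetric] circle_of_eq_iff
    by (rule exI[of _ "- round z"]) (simp add: x_def)
  have min: "\<bar>x - y\<bar> \<le> \<bar>a - b\<bar>" if "circle_of a = p" "circle_of b = circle_of y" for a b
  proof -
    obtain k l :: int where kl: "x0 - a = 2 * pi * of_int k" "b - y = 2 * pi * of_int l"
      using \<open>circle_of a = p\<close> \<open>circle_of b = circle_of y\<close> x0 circle_of_eq_iff by metis
    have 0: "x0 - y = 2 * pi * z" by (simp add: z_def)
    have 1: "x - y = 2 * pi * (z - of_int (round z))"
      using 0 by (simp add: x_def right_diff_distrib)
    have 2: "a - b = 2 * pi * (z - of_int (k + l))"
      using 0 kl by (simp add: right_diff_distrib distrib_left)
    have "\<bar>z - of_int (round z)\<bar> \<le> \<bar>z - of_int (k + l)\<bar>"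
      by (rule round_diff_minimal)
    then show ?thesis unfolding 1 2 by (simp add: abs_mult)
  qed
  have "\<bar>x - y\<bar> \<le> dist p (circle_of y)"
    unfolding dist_circle_def
    by (rule cInf_greatest) (use x min in \<open>auto simp: dist_real_def\<close>)
  moreover have "dist p (circle_of y) \<le> \<bar>x - y\<bar>"
    using dist_circle_le[of x y] x by simp
  ultimately show ?thesis using x by force
qed

instance
proof
  show "uniformity = (INF e\<in>{0 <..}. principal {(x, y::circle). dist x y < e})"
    by (rule uniformity_circle_def)
  show "open U \<longleftrightarrow> (\<forall>x\<in>U. eventually (\<lambda>(x', y). x' = x \<longrightarrow> y \<in> U) uniformity)"
    for U :: "circle set"
    by (rule open_circle_def)
  show "dist p q = 0 \<longleftrightarrow> p = q" for p q :: circle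
  proof -
    obtain y where y: "circle_of y = q" using circle_of_surj by blast
    obtain x where x: "circle_of x = p" "dist p q = \<bar>x - y\<bar>"
      using dist_circle_attained[of p y] y by blast
    have "dist q q \<le> 0" using dist_circle_le[of y y] y by simp
    moreover have "dist q q \<ge> 0" using dist_circle_attained[of q y] y by fastforce
    ultimately show ?thesis using x y by auto
  qed
  show "dist p q \<le> dist p r + dist q r" for p q r :: circle
  proof -
    obtain z where z: "circle_of z = r" using circle_of_surj by blast
    obtain x where x: "circle_of x = p" "dist p r = \<bar>x - z\<bar>"
      using dist_circle_attained[of p z] z by blast
    obtain y where y: "circle_of y = q" "dist q r = \<bar>y - z\<bar>"
      using dist_circle_attained[of q z] z by blast
    show ?thesis using dist_circle_le[of x y] x y by simp
  qed
qed

end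

text \<open>
  The metric that \<open>circle ^ 'n\<close> inherits as a finite Cartesian product is the quotient
  Euclidean metric of \<open>\<real>\<^sup>n / (2\<pi>\<int>)\<^sup>n\<close>; see \<open>dist_torus_eq_quotient_dist\<close>.
\<close>
type_synonym 'n torus = "circle ^ 'n"

definition torus_of :: "real ^ 'n \<Rightarrow> 'n::finite torus" where
  "torus_of x = (\<chi> i. circle_of (x $ i))"

lemma dist_torus_of_le: "dist (torus_of x) (torus_of y) \<le> dist x y"
  unfolding dist_vec_def torus_of_def
  by (rule L2_set_mono) (auto simp: dist_real_def dist_circle_le)

lemma dist_torus_attained: "\<exists>x. torus_of x = p \<and> dist p (torus_of y) = dist x y"
proof -
  have "\<forall>i. \<exists>a. circle_of a = p $ i \<and> dist (p $ i) (circle_of (y $ i)) = \<bar>a - y $ i\<bar>"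
    using dist_circle_attained by blast
  then obtain a where a: "\<And>i. circle_of (a i) = p $ i"
      "\<And>i. dist (p $ i) (circle_of (y $ i)) = \<bar>a i - y $ i\<bar>"
    by metis
  have "torus_of (\<chi> i. a i) = p" by (simp add: torus_of_def a vec_eq_iff)
  moreover have "dist p (torus_of y) = dist (\<chi> i. a i) y"
    by (simp add: dist_vec_def torus_of_def a dist_real_def)
  ultimately show ?thesis by blast
qed

lemma torus_of_surj: "\<exists>x. torus_of x = p"
  using dist_torus_attained by blast

lemma dist_torus_eq_quotient_dist:
  "dist p q = Inf {dist x y | x y. torus_of x = p \<and> torus_of y = q}"
proof (rule cInf_eq_minimum[symmetric])
  obtain y where y: "torus_of y = q" using torus_of_surj by blast
  then show "dist p q \<in> {dist x y | x y. torus_of x = p \<and> torus_of y = q}"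
    using dist_torus_attained[of p y] by blast
qed (use dist_torus_of_le in auto)


section \<open>Real analytic functions and gradients on the torus\<close>

text \<open>Local expansion in an (absolutely convergent) power series indexed by multi-indices.\<close>
definition real_analytic :: "(real ^ 'n \<Rightarrow> real) \<Rightarrow> bool" where
  "real_analytic f \<longleftrightarrow>
     (\<forall>x. \<exists>a :: ('n \<Rightarrow> nat) \<Rightarrow> real. \<exists>r>0. \<forall>y\<in>ball x r.
        ((\<lambda>\<alpha>. a \<alpha> * (\<Prod>i\<in>UNIV. (y $ i - x $ i) ^ \<alpha> i)) has_sum f y) UNIV)"

definition torus_real_analytic :: "('n::finite torus \<Rightarrow> real) \<Rightarrow> bool" where
  "torus_real_analytic Q \<longleftrightarrow> real_analytic (Q \<circ> torus_of)"

definition torus_gradient :: "('n::finite torus \<Rightarrow> real) \<Rightarrow> 'n torus \<Rightarrow> real ^ 'n" where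
  "torus_gradient Q p = (THE g. \<forall>x. torus_of x = p \<longrightarrow> GDERIV (Q \<circ> torus_of) x :> g)"


section \<open>Curves of class H1 on the torus\<close>

definition L2_on :: "real set \<Rightarrow> (real \<Rightarrow> real ^ 'n) \<Rightarrow> bool" where
  "L2_on S v \<longleftrightarrow> v \<in> borel_measurable (lebesgue_on S) \<and>
     set_integrable lebesgue S (\<lambda>t. (norm (v t))\<^sup>2)"

text \<open>Continuously differentiable functions with compact support in \<open>{0<..<T}\<close>,
  together with their derivative.\<close>
definition test_function :: "real \<Rightarrow> (real \<Rightarrow> real) \<Rightarrow> (real \<Rightarrow> real) \<Rightarrow> bool" where
  "test_function T \<eta> \<eta>' \<longleftrightarrow>
     (\<forall>t. (\<eta> has_real_derivative \<eta>' t) (at t)) \<and> continuous_on UNIV \<eta>' \<and>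
     (\<exists>a b. 0 < a \<and> a \<le> b \<and> b < T \<and> (\<forall>t. t \<notin> {a..b} \<longrightarrow> \<eta> t = 0))"

definition weak_derivative_on :: "real \<Rightarrow> (real \<Rightarrow> real ^ 'n) \<Rightarrow> (real \<Rightarrow> real ^ 'n) \<Rightarrow> bool" where
  "weak_derivative_on T \<phi> v \<longleftrightarrow>
     (\<forall>\<eta> \<eta>'. test_function T \<eta> \<eta>' \<longrightarrow>
        (LINT t:{0<..<T}|lebesgue. \<eta>' t *\<^sub>R \<phi> t) = - (LINT t:{0<..<T}|lebesgue. \<eta> t *\<^sub>R v t))"

text \<open>
  A curve in the torus is differentiated through a continuous lift to \<open>\<real>\<^sup>n\<close>. Such a lift is unique
  up to a constant, so that the velocity is unique almost everywhere. Only the values of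
  a curve on \<open>{0..}\<close> matter.
\<close>
definition is_velocity :: "(real \<Rightarrow> 'n::finite torus) \<Rightarrow> (real \<Rightarrow> real ^ 'n) \<Rightarrow> bool" where
  "is_velocity \<Phi> v \<longleftrightarrow>
     (\<exists>\<phi>. continuous_on {0..} \<phi> \<and> (\<forall>t\<ge>0. \<Phi> t = torus_of (\<phi> t)) \<and>
        (\<forall>T>0. L2_on {0<..<T} v \<and> weak_derivative_on T \<phi> v))"

definition H1_loc :: "(real \<Rightarrow> 'n::finite torus) set" where
  "H1_loc = {\<Phi>. \<exists>v. is_velocity \<Phi> v}"

definition velocity :: "(real \<Rightarrow> 'n::finite torus) \<Rightarrow> real \<Rightarrow> real ^ 'n" where
  "velocity \<Phi> = (SOME v. is_velocity \<Phi> v)"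


section \<open>Value function and value iteration\<close>

definition lagrangian :: "('n::finite torus \<Rightarrow> real) \<Rightarrow> (real \<Rightarrow> 'n torus) \<Rightarrow> real \<Rightarrow> real" where
  "lagrangian Q \<Phi> t = 1/2 * (norm (velocity \<Phi> t))\<^sup>2 + Q (\<Phi> t)"

definition admissible :: "('n::finite torus \<Rightarrow> real) \<Rightarrow> 'n torus \<Rightarrow> (real \<Rightarrow> 'n torus) set" where
  "admissible Q \<theta> =
     {\<Phi> \<in> H1_loc. \<Phi> 0 = \<theta> \<and> set_integrable lebesgue {0<..} (lagrangian Q \<Phi>)}"

definition value_function :: "('n::finite torus \<Rightarrow> real) \<Rightarrow> 'n torus \<Rightarrow> real" where
  "value_function Q \<theta> = (INF \<Phi>\<in>admissible Q \<theta>. LINT t:{0<..}|lebesgue. lagrangian Q \<Phi> t)"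

definition zero_set :: "('n::finite torus \<Rightarrow> real) \<Rightarrow> 'n torus set" where
  "zero_set Q = {\<theta>. Q \<theta> = 0}"

text \<open>The supremum is a maximum whenever \<open>Q\<close> is continuously differentiable, by compactness.\<close>
definition max_gradient :: "('n::finite torus \<Rightarrow> real) \<Rightarrow> real" where
  "max_gradient Q = (SUP \<theta>. norm (torus_gradient Q \<theta>))"

primrec value_iteration :: "('n::finite torus \<Rightarrow> real) \<Rightarrow> real \<Rightarrow> nat \<Rightarrow> 'n torus \<Rightarrow> real" where
  "value_iteration Q \<delta> 0 = (\<lambda>\<theta>.
     1/2 * (infdist \<theta> (zero_set Q))\<^sup>2 + max_gradient Q / 2 * infdist \<theta> (zero_set Q))"
| "value_iteration Q \<delta> (Suc i) = (\<lambda>\<theta>.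
     INF \<Phi>\<in>admissible Q \<theta>.
       (LINT s:{0<..<\<delta>}|lebesgue. lagrangian Q \<Phi> s) + value_iteration Q \<delta> i (\<Phi> \<delta>))"

end

theory Submission
  imports Defs
begin

text \<open>
  The value function lies below every \<open>V\<^sub>i\<close>: it does for \<open>V\<^sub>0\<close>, by running along a segment to the zero set in
  unit time, and dynamic programming propagates the inequality. Conversely \<open>V\<^sub>i \<theta>\<close> is at most the cost of
  a curve up to \<open>T = i \<delta>\<close> plus \<open>V\<^sub>0\<close> at its position at time \<open>T\<close>. Along a nearly optimal curve some time
  \<open>t\<^sub>0 \<le> T\<close> has potential at most (cost)\<open>/T\<close>, so by the Lojasiewicz inequality the curve is then close to the
  zero set, and near-optimality makes the cost after \<open>t\<^sub>0\<close> at most about \<open>V\<^sub>0\<close> there. Since the cost on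
  \<open>[T, T + 1]\<close> dominates a power of the distance to the zero set at time \<open>T\<close>, that distance is small too.
\<close>

section \<open>Real analytic functions on the torus are Lipschitz\<close>

text \<open>Origin of the constants: with D = 2 pi sqrt n bounding all distances, V_0 <= (D+L)/2
  dist. This linear bound gives the total budget (D+L)/2 D, hence the factor D in the threshold, and
  converts closeness to the zero set into a bound on the remaining cost. Let M be the maximum in
  \<open>\<sigma>1\<close>; M times the cost on [T, T+1] dominates dist^\<open>N'\<close> at time T.
  Up to slack, dist^\<open>N'\<close> <= \<open>\<sigma>1\<close> ((D+L) D / (2 d T))^(1/N), and the
  N-th power of the right side is D \<open>\<sigma>2\<close> / T. The condition on i puts this below
  e^(\<open>N'\<close> N), where e > 0 solves e^2/2 + L e/2 = epsilon. Infima are not shown to be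
  attained: curves are optimal up to a slack that tends to 0 at the end, and the strict condition on
  i restores strictness. Torus curves with weak derivatives, Lebesgue integrals and a chosen
  velocity are awkward to cut and glue. The work is therefore done on lifts to R^n that are
  primitives, with gauge integrals on compact intervals. Analyticity enters through a Lipschitz
  bound with constant L.\<close>

lemma monomial_le:
  fixes h :: "real ^ 'n"
  assumes "\<And>i. \<bar>h $ i\<bar> \<le> s"
  shows "\<bar>\<Prod>i\<in>UNIV. h $ i ^ \<alpha> i\<bar> \<le> s ^ (\<Sum>i\<in>UNIV. \<alpha> i)"
  unfolding abs_prod power_sum power_abs using assms by (intro prod_mono) (auto intro: power_mono)

text \<open>After rescaling by \<open>s / 2\<close> all entries lie in [-1, 1], where a monomial of
  degree m is Lipschitz up to a factor m. Halving the radius pays for this factor, because m <= 2^m.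
  The bound is thus a multiple of the monomial at the corner \<open>(s, ..., s)\<close>.\<close>

lemma monomial_diff_le:
  fixes h k :: "real ^ 'n"
  assumes "0 < s" and h: "\<And>i. \<bar>h $ i\<bar> \<le> s / 2" and k: "\<And>i. \<bar>k $ i\<bar> \<le> s / 2"
  shows "\<bar>(\<Prod>i\<in>UNIV. h $ i ^ \<alpha> i) - (\<Prod>i\<in>UNIV. k $ i ^ \<alpha> i)\<bar>
    \<le> s ^ (\<Sum>i\<in>UNIV. \<alpha> i) * (2 / s * norm (h - k))"
proof -
  let ?m = "\<Sum>i\<in>UNIV. \<alpha> i"
  define u w where "u i = h $ i / (s / 2)" and "w i = k $ i / (s / 2)" for i
  have u: "\<bar>u i\<bar> \<le> 1" and w: "\<bar>w i\<bar> \<le> 1" for i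
    using h[of i] k[of i] \<open>0 < s\<close> by (auto simp: u_def w_def abs_mult field_simps)
  have uw: "\<bar>u i - w i\<bar> \<le> 2 / s * norm (h - k)" for i
  proof -
    have "u i - w i = 2 / s * ((h - k) $ i)" using \<open>0 < s\<close> by (simp add: u_def w_def field_simps)
    then show ?thesis using component_le_norm_cart[of "h - k" i] \<open>0 < s\<close>
      by (simp add: abs_mult divide_right_mono)
  qed
  have hu: "(\<Prod>i\<in>UNIV. h $ i ^ \<alpha> i) = (s / 2) ^ ?m * (\<Prod>i\<in>UNIV. u i ^ \<alpha> i)"
    using \<open>0 < s\<close> by (simp add: power_sum prod.distrib[symmetric] power_mult_distrib[symmetric] u_def)
  have kw: "(\<Prod>i\<in>UNIV. k $ i ^ \<alpha> i) = (s / 2) ^ ?m * (\<Prod>i\<in>UNIV. w i ^ \<alpha> i)"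
    using \<open>0 < s\<close> by (simp add: power_sum prod.distrib[symmetric] power_mult_distrib[symmetric] w_def)
  have "\<bar>(\<Prod>i\<in>UNIV. u i ^ \<alpha> i) - (\<Prod>i\<in>UNIV. w i ^ \<alpha> i)\<bar> \<le> (\<Sum>i\<in>UNIV. \<bar>u i ^ \<alpha> i - w i ^ \<alpha> i\<bar>)"
    using norm_prod_diff[of UNIV "\<lambda>i. u i ^ \<alpha> i" "\<lambda>i. w i ^ \<alpha> i"] u w
    by (simp add: power_abs power_le_one)
  also have "\<dots> \<le> (\<Sum>i\<in>UNIV. real (\<alpha> i) * (2 / s * norm (h - k)))"
  proof (rule sum_mono)
    fix i
    have "\<bar>u i ^ \<alpha> i - w i ^ \<alpha> i\<bar> \<le> real (\<alpha> i) * \<bar>u i - w i\<bar>"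
      using norm_power_diff[of "u i" "w i" "\<alpha> i"] u w by simp
    also have "\<dots> \<le> real (\<alpha> i) * (2 / s * norm (h - k))"
      by (intro mult_left_mono uw) simp
    finally show "\<bar>u i ^ \<alpha> i - w i ^ \<alpha> i\<bar> \<le> real (\<alpha> i) * (2 / s * norm (h - k))" .
  qed
  also have "\<dots> = real ?m * (2 / s * norm (h - k))"
    by (simp only: of_nat_sum sum_distrib_right)
  also have "\<dots> \<le> 2 ^ ?m * (2 / s * norm (h - k))"
  proof (rule mult_right_mono)
    have "?m < 2 ^ ?m" by (rule less_exp)
    then have "real ?m < real (2 ^ ?m)" by (rule of_nat_less_iff[THEN iffD2])
    then show "real ?m \<le> 2 ^ ?m" by simp
  qed (use \<open>0 < s\<close> in simp)
  finally have "(s / 2) ^ ?m * \<bar>(\<Prod>i\<in>UNIV. u i ^ \<alpha> i) - (\<Prod>i\<in>UNIV. w i ^ \<alpha> i)\<bar>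
      \<le> (s / 2) ^ ?m * (2 ^ ?m * (2 / s * norm (h - k)))"
    using \<open>0 < s\<close> by (intro mult_left_mono) auto
  also have "\<dots> = s ^ ?m * (2 / s * norm (h - k))"
    by (simp add: power_divide)
  finally show ?thesis
    unfolding hu kw using \<open>0 < s\<close> by (simp add: right_diff_distrib[symmetric] abs_mult)
qed

text \<open>Absolute convergence at the single point \<open>x + (s, ..., s)\<close> yields a finite
  sum \<open>C\<close> that dominates, term by term, both the difference of two values and the
  remainder after degree one. This replaces termwise differentiation.\<close>

lemma power_series_local_bounds:
  fixes f :: "real ^ 'n \<Rightarrow> real" and a :: "('n \<Rightarrow> nat) \<Rightarrow> real"
  assumes "0 < r" and f: "\<And>y. y \<in> ball x r \<Longrightarrow>
    ((\<lambda>\<alpha>. a \<alpha> * (\<Prod>i\<in>UNIV. (y $ i - x $ i) ^ \<alpha> i)) has_sum f y) UNIV"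
  obtains K g s where "0 < s" "0 \<le> K"
    "\<And>y z. y \<in> ball x s \<Longrightarrow> z \<in> ball x s \<Longrightarrow> \<bar>f y - f z\<bar> \<le> K * norm (y - z)"
    "\<And>y. y \<in> ball x s \<Longrightarrow> \<bar>f y - f x - (y - x) \<bullet> g\<bar> \<le> K * (norm (y - x))\<^sup>2"
proof -
  define T where "T h \<alpha> = a \<alpha> * (\<Prod>i\<in>UNIV. h $ i ^ \<alpha> i)" for h :: "real ^ 'n" and \<alpha>
  have fT: "(T (y - x) has_sum f y) UNIV" if "y \<in> ball x r" for y
    using f[OF that] unfolding T_def[abs_def] by simp
  \<comment> \<open>Chosen so that the corner \<open>(s, ..., s)\<close> has l1 norm
    \<open>r / 2\<close> and hence stays in the ball of convergence.\<close>
  define s where "s = r / (2 * real CARD('n))"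
  have s: "0 < s" using \<open>0 < r\<close> by (simp add: s_def)
  have "s \<le> r / 2" using \<open>0 < r\<close> by (simp add: s_def field_simps)
  then have sr: "s / 2 \<le> r" using s by simp
  let ?z = "x + (\<chi> i. s)"
  have "norm (\<chi> i. s :: real ^ 'n) \<le> (\<Sum>i\<in>(UNIV :: 'n set). \<bar>(\<chi> i. s) $ i\<bar>)" by (rule norm_le_l1_cart)
  also have "\<dots> = r / 2" using \<open>0 < r\<close> by (simp add: s_def)
  finally have "?z \<in> ball x r" using \<open>0 < r\<close> by (simp add: dist_norm)
  from fT[OF this] have "T (\<chi> i. s) summable_on UNIV" by (auto simp: summable_on_def)
  then have "(\<lambda>\<alpha>. norm (T (\<chi> i. s) \<alpha>)) summable_on UNIV"
    by (rule summable_on_iff_abs_summable_on_real[THEN iffD1])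
  moreover have "norm (T (\<chi> i. s) \<alpha>) = \<bar>a \<alpha>\<bar> * s ^ (\<Sum>i\<in>UNIV. \<alpha> i)" for \<alpha>
    using s by (simp add: T_def abs_mult power_sum abs_prod)
  ultimately have "(\<lambda>\<alpha>. \<bar>a \<alpha>\<bar> * s ^ (\<Sum>i\<in>UNIV. \<alpha> i)) summable_on UNIV" by (simp only:)
  then obtain C where C: "((\<lambda>\<alpha>. \<bar>a \<alpha>\<bar> * s ^ (\<Sum>i\<in>UNIV. \<alpha> i)) has_sum C) UNIV"
    by (auto simp: summable_on_def)
  have "0 \<le> C" by (rule has_sum_nonneg[OF C]) (use s in auto)
  have dominated: "\<bar>u\<bar> \<le> C * c"
    if "(t has_sum u) UNIV" "\<And>\<alpha>. \<bar>t \<alpha>\<bar> \<le> \<bar>a \<alpha>\<bar> * s ^ (\<Sum>i\<in>UNIV. \<alpha> i) * c" for t u c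
  proof -
    have B: "((\<lambda>\<alpha>. \<bar>a \<alpha>\<bar> * s ^ (\<Sum>i\<in>UNIV. \<alpha> i) * c) has_sum (C * c)) UNIV"
      by (rule has_sum_cmult_left[OF C])
    have N: "((\<lambda>\<alpha>. - t \<alpha>) has_sum - u) UNIV"
      using has_sum_cmult_right[OF that(1), of "- 1"] by simp
    have "u \<le> C * c" by (rule has_sum_mono[OF that(1) B]) (rule abs_le_D1[OF that(2)])
    moreover have "- u \<le> C * c" by (rule has_sum_mono[OF N B]) (rule abs_le_D2[OF that(2)])
    ultimately show ?thesis by simp
  qed
  have has_sum_diff: "((\<lambda>\<alpha>. t \<alpha> - t' \<alpha>) has_sum (u - u')) UNIV"
    if "(t has_sum u) UNIV" "(t' has_sum u') UNIV" for t t' :: "('n \<Rightarrow> nat) \<Rightarrow> real" and u u'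
    using has_sum_add[OF that(1) has_sum_cmult_right[OF that(2), of "- 1"]] by simp
  have comp: "\<bar>(y - x) $ i\<bar> \<le> s / 2" if "y \<in> ball x (s / 2)" for y i
    using component_le_norm_cart[of "y - x" i] that by (simp add: dist_norm norm_minus_commute)
  have lip: "\<bar>f y - f z\<bar> \<le> C * (2 / s * norm (y - z))"
    if y: "y \<in> ball x (s / 2)" and z: "z \<in> ball x (s / 2)" for y z
  proof (rule dominated)
    show "((\<lambda>\<alpha>. T (y - x) \<alpha> - T (z - x) \<alpha>) has_sum f y - f z) UNIV"
      using y z sr by (intro has_sum_diff fT) auto
    show "\<bar>T (y - x) \<alpha> - T (z - x) \<alpha>\<bar> \<le> \<bar>a \<alpha>\<bar> * s ^ (\<Sum>i\<in>UNIV. \<alpha> i) * (2 / s * norm (y - z))" for \<alpha>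
      using mult_left_mono[OF monomial_diff_le[OF s comp[OF y] comp[OF z], of \<alpha>] abs_ge_zero[of "a \<alpha>"]]
      by (simp add: T_def right_diff_distrib[symmetric] abs_mult[symmetric] mult.assoc)
  qed
  define e :: "'n \<Rightarrow> 'n \<Rightarrow> nat" where "e j = (\<lambda>i. if i = j then 1 else 0)" for j
  \<comment> \<open>The multi-indices of degree at most one; \<open>e j\<close> is the j-th unit
    index, so that the terms over \<open>F\<close> sum to the affine part with gradient
    \<open>g\<close>.\<close>
  define F where "F = insert (\<lambda>_. 0) (range e)"
  define g :: "real ^ 'n" where "g = (\<chi> j. a (e j))"
  have inj_e: "inj e" by (auto simp: inj_def e_def fun_eq_iff split: if_splits)
  have e0: "e j \<noteq> (\<lambda>_. 0)" for j by (auto simp: e_def fun_eq_iff)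
  have prod_e: "(\<Prod>i\<in>UNIV. h $ i ^ e j i) = h $ j" for h :: "real ^ 'n" and j
  proof -
    have "(\<Prod>i\<in>UNIV. h $ i ^ e j i) = (\<Prod>i\<in>UNIV. if i = j then h $ i else 1)"
      by (rule prod.cong) (auto simp: e_def)
    then show ?thesis by simp
  qed
  have sumF: "sum (T h) F = a (\<lambda>_. 0) + h \<bullet> g" for h
  proof -
    have "sum (T h) F = T h (\<lambda>_. 0) + sum (T h) (range e)"
      unfolding F_def by (rule sum.insert) (use e0 in \<open>auto simp: eq_commute\<close>)
    also have "sum (T h) (range e) = (\<Sum>j\<in>UNIV. T h (e j))" by (simp add: sum.reindex[OF inj_e])
    finally show ?thesis
      by (simp add: T_def prod_e g_def inner_vec_def mult.commute)
  qed
  have F: "\<alpha> \<in> F" if "(\<Sum>i\<in>UNIV. \<alpha> i) < 2" for \<alpha> :: "'n \<Rightarrow> nat"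
  proof (cases "(\<Sum>i\<in>UNIV. \<alpha> i) = 0")
    case True
    then have "\<alpha> = (\<lambda>_. 0)" by (simp add: fun_eq_iff)
    then show ?thesis by (simp add: F_def)
  next
    case False
    then have "(\<Sum>i\<in>UNIV. \<alpha> i) = 1" using that by linarith
    then obtain j where "\<alpha> j = 1" "\<And>i. j \<noteq> i \<Longrightarrow> \<alpha> i = 0" by (subst (asm) sum_eq_1_iff) auto
    then have "\<alpha> = e j" by (auto simp: fun_eq_iff e_def)
    then show ?thesis by (simp add: F_def)
  qed
  have remainder: "\<bar>f y - (a (\<lambda>_. 0) + (y - x) \<bullet> g)\<bar> \<le> C * (norm (y - x) / s)\<^sup>2" if y: "y \<in> ball x (s / 2)" for y
  proof (rule dominated)
    let ?h = "y - x"
    have "((\<lambda>\<alpha>. if \<alpha> \<in> F then T ?h \<alpha> else 0) has_sum (sum (T ?h) F)) UNIV"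
      by (rule has_sum_cong_neutral[THEN iffD1, of UNIV F _ "T ?h"]) (auto simp: F_def intro: has_sum_finite)
    from has_sum_diff[OF fT this]
    show "((\<lambda>\<alpha>. T ?h \<alpha> - (if \<alpha> \<in> F then T ?h \<alpha> else 0)) has_sum f y - (a (\<lambda>_. 0) + ?h \<bullet> g)) UNIV"
      using y sr unfolding sumF by auto
    fix \<alpha> :: "'n \<Rightarrow> nat"
    let ?m = "\<Sum>i\<in>UNIV. \<alpha> i"
    show "\<bar>T ?h \<alpha> - (if \<alpha> \<in> F then T ?h \<alpha> else 0)\<bar> \<le> \<bar>a \<alpha>\<bar> * s ^ ?m * (norm ?h / s)\<^sup>2"
    proof (cases "\<alpha> \<in> F")
      case True then show ?thesis using s by simp
    next
      case False
      then have m: "2 \<le> ?m" using F[of \<alpha>] by linarith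
      have "norm ?h \<le> s" using y s by (simp add: dist_norm norm_minus_commute)
      have "\<bar>\<Prod>i\<in>UNIV. ?h $ i ^ \<alpha> i\<bar> \<le> norm ?h ^ ?m"
        by (rule monomial_le) (rule component_le_norm_cart)
      also have "\<dots> = s ^ ?m * (norm ?h / s) ^ ?m" using s by (simp add: power_divide)
      \<comment> \<open>Outside \<open>F\<close> the degree is at least 2, and
        \<open>norm ?h / s\<close> is at most 1, so lowering the exponent to 2 only increases the
        power.\<close>
      also have "\<dots> \<le> s ^ ?m * (norm ?h / s)\<^sup>2"
        using \<open>norm ?h \<le> s\<close> s m by (intro mult_left_mono power_decreasing) auto
      finally show ?thesis using False
        by (simp add: T_def abs_mult mult_left_mono mult.assoc)
    qed
  qed
  have fx: "f x = a (\<lambda>_. 0)"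
    using remainder[of x] s by simp
  show thesis
  proof (rule that[of "s / 2" "C * (2 / s) + C / s\<^sup>2" g])
    show "0 < s / 2" "0 \<le> C * (2 / s) + C / s\<^sup>2" using s \<open>0 \<le> C\<close> by auto
    show "\<bar>f y - f z\<bar> \<le> (C * (2 / s) + C / s\<^sup>2) * norm (y - z)" if "y \<in> ball x (s/2)" "z \<in> ball x (s/2)" for y z
    proof -
      have "0 \<le> C / s\<^sup>2 * norm (y - z)" using \<open>0 \<le> C\<close> by simp
      then show ?thesis using lip[OF that] by (simp add: algebra_simps)
    qed
    show "\<bar>f y - f x - (y - x) \<bullet> g\<bar> \<le> (C * (2 / s) + C / s\<^sup>2) * (norm (y - x))\<^sup>2" if "y \<in> ball x (s/2)" for y
    proof -
      have "0 \<le> C * (2 / s) * (norm (y - x))\<^sup>2" using \<open>0 \<le> C\<close> s by simp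
      moreover have "\<bar>f y - f x - (y - x) \<bullet> g\<bar> \<le> C / s\<^sup>2 * (norm (y - x))\<^sup>2"
        using remainder[OF that] by (simp add: fx power_divide diff_diff_eq)
      ultimately show ?thesis by (simp add: distrib_right)
    qed
  qed
qed

lemma GDERIV_of_quadratic_bound:
  fixes f :: "'a::real_inner \<Rightarrow> real"
  assumes "0 < s" and f: "\<And>y. y \<in> ball x s \<Longrightarrow> \<bar>f y - f x - (y - x) \<bullet> g\<bar> \<le> K * (norm (y - x))\<^sup>2"
  shows "GDERIV f x :> g"
  unfolding gderiv_def has_derivative_iff_norm
proof (intro conjI)
  show "bounded_linear (\<lambda>h. h \<bullet> g)" by (rule bounded_linear_inner_left)
  show "((\<lambda>y. norm (f y - f x - (y - x) \<bullet> g) / norm (y - x)) \<longlongrightarrow> 0) (at x)"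
  proof (rule Lim_null_comparison)
    have "\<forall>\<^sub>F y in at x. y \<in> ball x s" using \<open>0 < s\<close> by (intro eventually_at_in_open') auto
    then show "\<forall>\<^sub>F y in at x. norm (norm (f y - f x - (y - x) \<bullet> g) / norm (y - x)) \<le> K * norm (y - x)"
    proof eventually_elim
      case (elim y)
      then show ?case using f[OF elim] by (cases "y = x") (auto simp: field_simps power2_eq_square)
    qed
    show "((\<lambda>y. K * norm (y - x)) \<longlongrightarrow> 0) (at x)" by (auto intro!: tendsto_eq_intros)
  qed
qed

text \<open>Along the direction \<open>g\<close> itself the difference quotients tend to
  \<open>g \<bullet> g\<close>, while the Lipschitz bound keeps them below
  \<open>K * norm g\<close>.\<close>

lemma norm_gradient_le_of_local_Lipschitz:
  fixes f :: "'a::real_inner \<Rightarrow> real"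
  assumes D: "GDERIV f x :> g" and "0 < s" "0 \<le> K"
    and f: "\<And>y. y \<in> ball x s \<Longrightarrow> \<bar>f y - f x\<bar> \<le> K * norm (y - x)"
  shows "norm g \<le> K"
proof (cases "g = 0")
  case False
  have "((\<lambda>t. f (x + t *\<^sub>R g)) has_derivative (\<lambda>t. t *\<^sub>R g \<bullet> g)) (at 0)"
    by (rule has_derivative_compose[where f = "\<lambda>t. x + t *\<^sub>R g" and f' = "\<lambda>t. t *\<^sub>R g"])
       (auto intro!: derivative_eq_intros D[unfolded gderiv_def])
  then have "((\<lambda>t. f (x + t *\<^sub>R g)) has_real_derivative g \<bullet> g) (at 0)"
    by (simp add: has_field_derivative_def mult_commute_abs)
  then have lim: "((\<lambda>t. (f (x + t *\<^sub>R g) - f x) / t) \<longlongrightarrow> g \<bullet> g) (at 0)"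
    by (simp add: DERIV_def)
  have "g \<bullet> g \<le> K * norm g"
  proof (rule tendsto_upperbound[OF lim])
    have "\<forall>\<^sub>F t::real in at 0. t \<in> ball 0 (s / norm g)"
      using \<open>0 < s\<close> False by (intro eventually_at_in_open') auto
    moreover have "\<forall>\<^sub>F t::real in at 0. t \<noteq> 0" by (simp add: eventually_at_filter)
    ultimately show "\<forall>\<^sub>F t in at 0. (f (x + t *\<^sub>R g) - f x) / t \<le> K * norm g"
    proof eventually_elim
      case (elim t)
      have "x + t *\<^sub>R g \<in> ball x s" using elim False by (simp add: dist_norm field_simps)
      from f[OF this] have "\<bar>(f (x + t *\<^sub>R g) - f x) / t\<bar> \<le> K * norm g"
        using elim by (simp add: abs_divide divide_le_eq mult_ac)
      then show ?case by linarith
    qed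
  qed simp
  then have "norm g * norm g \<le> K * norm g" by (simp add: power2_norm_eq_inner[symmetric] power2_eq_square)
  then show ?thesis using False by (simp add: mult_le_cancel_right)
qed (use \<open>0 \<le> K\<close> in simp)


section \<open>Lifts, fundamental cell and gradients on the torus\<close>

lemma torus_of_eq_iff:
  "torus_of x = torus_of y \<longleftrightarrow> (\<forall>i. \<exists>k::int. x $ i - y $ i = 2 * pi * of_int k)"
  by (simp add: torus_of_def vec_eq_iff circle_of_eq_iff)

lemma torus_of_add_cong: "torus_of x = torus_of y \<Longrightarrow> torus_of (x + h) = torus_of (y + h)"
  by (simp add: torus_of_eq_iff)

lemma torus_of_fundamental_cell: "\<exists>x \<in> cbox 0 (\<chi> i. 2 * pi). torus_of x = p"
proof -
  obtain y where y: "torus_of y = p" using torus_of_surj by blast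
  define x where "x = (\<chi> i. y $ i - 2 * pi * of_int \<lfloor>y $ i / (2 * pi)\<rfloor>)"
  have "0 \<le> x $ i \<and> x $ i \<le> 2 * pi" for i
  proof -
    have *: "of_int \<lfloor>y $ i / (2 * pi)\<rfloor> \<le> y $ i / (2 * pi)" "y $ i / (2 * pi) \<le> of_int \<lfloor>y $ i / (2 * pi)\<rfloor> + 1"
      by linarith+
    have "2 * pi * of_int \<lfloor>y $ i / (2 * pi)\<rfloor> \<le> y $ i" "y $ i \<le> 2 * pi * (of_int \<lfloor>y $ i / (2 * pi)\<rfloor> + 1)"
      using mult_left_mono[OF *(1), of "2 * pi"] mult_left_mono[OF *(2), of "2 * pi"] by simp_all
    then show ?thesis by (simp add: x_def algebra_simps)
  qed
  then have "x \<in> cbox 0 (\<chi> i. 2 * pi)" by (simp add: mem_box_cart)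
  moreover have "torus_of x = torus_of y"
    unfolding torus_of_eq_iff
  proof
    fix i
    show "\<exists>k::int. x $ i - y $ i = 2 * pi * of_int k"
      by (rule exI[of _ "- \<lfloor>y $ i / (2 * pi)\<rfloor>"]) (simp add: x_def)
  qed
  ultimately show ?thesis using y by metis
qed

text \<open>A representative \<open>x\<close> of the difference of the two points is taken in the
  cell; then \<open>x + y\<close> lifts \<open>p\<close> at distance \<open>norm x\<close> from
  \<open>y\<close>. The diagonal of the cell is the quantity 2 pi sqrt n of the final
  estimate.\<close>

lemma dist_torus_le_diameter: "dist p q \<le> 2 * pi * sqrt (real CARD('n))" for p q :: "'n::finite torus"
proof -
  obtain y where y: "torus_of y = q" using torus_of_surj by blast
  obtain x0 where x0: "torus_of x0 = p" using torus_of_surj by blast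
  obtain x where x: "x \<in> cbox 0 (\<chi> i. 2 * pi)" "torus_of x = torus_of (x0 - y)"
    using torus_of_fundamental_cell[of "torus_of (x0 - y)"] by auto
  have "torus_of (x + y) = p" using torus_of_add_cong[OF x(2), of y] x0 by simp
  then have "dist p q \<le> dist (x + y) y" using dist_torus_of_le[of "x + y" y] y by simp
  also have "\<dots> = norm x" by (simp add: dist_norm)
  also have "\<dots> \<le> L2_set (\<lambda>i. 2 * pi) (UNIV :: 'n set)"
    unfolding norm_vec_def using x(1) by (intro L2_set_mono) (auto simp: mem_box_cart)
  also have "\<dots> = 2 * pi * sqrt (real CARD('n))" by (simp add: L2_set_def real_sqrt_mult)
  finally show ?thesis .
qed

lemma GDERIV_unique:
  assumes "GDERIV f x :> g" "GDERIV f x :> g'"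
  shows "g = g'"
proof -
  have "(\<lambda>h. h \<bullet> g) = (\<lambda>h. h \<bullet> g')"
    using assms unfolding gderiv_def by (rule has_derivative_unique)
  then show ?thesis by (metis inner_commute vector_eq_ldot)
qed

text \<open>The definite description ranges over all lifts of a point, so a derivative at one lift
  has to be carried to the others. Periodicity does this: two lifts of a point differ by a
  translation that leaves \<open>Q \<circ> torus_of\<close> unchanged.\<close>

lemma torus_gradient_eqI:
  assumes D: "GDERIV (Q \<circ> torus_of) x :> g"
  shows "torus_gradient Q (torus_of x) = g"
  unfolding torus_gradient_def
proof (rule the_equality)
  show "\<forall>y. torus_of y = torus_of x \<longrightarrow> GDERIV (Q \<circ> torus_of) y :> g"
  proof (intro allI impI)
    fix y assume "torus_of y = torus_of x"
    then have "torus_of (z + (x - y)) = torus_of z" for z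
      using torus_of_add_cong[of y x "z - y"] by (simp add: algebra_simps)
    then have eq: "(Q \<circ> torus_of) = (\<lambda>z. (Q \<circ> torus_of) (z + (x - y)))" by (simp add: fun_eq_iff)
    have "((\<lambda>z. (Q \<circ> torus_of) (z + (x - y))) has_derivative (\<lambda>h. h \<bullet> g)) (at y)"
    proof (rule has_derivative_compose[where f = "\<lambda>z. z + (x - y)" and f' = "\<lambda>h. h"])
      show "((\<lambda>z. z + (x - y)) has_derivative (\<lambda>h. h)) (at y)" by (auto intro!: derivative_eq_intros)
      have "y + (x - y) = x" by simp
      then show "(Q \<circ> torus_of has_derivative (\<lambda>h. h \<bullet> g)) (at (y + (x - y)))"
        using D unfolding gderiv_def by (simp only:)
    qed
    then show "GDERIV (Q \<circ> torus_of) y :> g" unfolding gderiv_def by (subst eq)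
  qed
  show "g' = g" if "\<forall>y. torus_of y = torus_of x \<longrightarrow> GDERIV (Q \<circ> torus_of) y :> g'" for g'
    using that D GDERIV_unique by blast
qed

text \<open>\<open>max_gradient\<close> is a supremum, which bounds the gradients once they are
  known to be bounded. Boundedness comes from a finite cover of the compact fundamental cell by
  balls with local Lipschitz constants; the mean value inequality on R^n then gives the global
  constant.\<close>

lemma torus_real_analytic_Lipschitz:
  fixes Q :: "'n::finite torus \<Rightarrow> real"
  assumes Q: "torus_real_analytic Q"
  shows "\<bar>Q (torus_of x) - Q (torus_of y)\<bar> \<le> max_gradient Q * norm (x - y)" "0 \<le> max_gradient Q"
proof -
  let ?f = "Q \<circ> torus_of"
  have "\<exists>K g s. 0 < s \<and> 0 \<le> K \<and>
      (\<forall>y\<in>ball x s. \<forall>z\<in>ball x s. \<bar>?f y - ?f z\<bar> \<le> K * norm (y - z)) \<and>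
      (\<forall>y\<in>ball x s. \<bar>?f y - ?f x - (y - x) \<bullet> g\<bar> \<le> K * (norm (y - x))\<^sup>2)" for x
  proof -
    obtain a r where "0 < r" "\<And>y. y \<in> ball x r \<Longrightarrow>
        ((\<lambda>\<alpha>. a \<alpha> * (\<Prod>i\<in>UNIV. (y $ i - x $ i) ^ \<alpha> i)) has_sum ?f y) UNIV"
      using Q unfolding torus_real_analytic_def real_analytic_def by blast
    from power_series_local_bounds[OF this] show ?thesis by metis
  qed
  then obtain K g s where s: "\<And>x. 0 < s x" and K: "\<And>x. 0 \<le> K x"
    and lip: "\<And>x y z. y \<in> ball x (s x) \<Longrightarrow> z \<in> ball x (s x) \<Longrightarrow> \<bar>?f y - ?f z\<bar> \<le> K x * norm (y - z)"
    and quad: "\<And>x y. y \<in> ball x (s x) \<Longrightarrow> \<bar>?f y - ?f x - (y - x) \<bullet> g x\<bar> \<le> K x * (norm (y - x))\<^sup>2"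
    by metis
  have D: "GDERIV ?f x :> g x" for x
    using GDERIV_of_quadratic_bound[OF s quad] by blast
  have grad: "torus_gradient Q (torus_of x) = g x" for x
    by (rule torus_gradient_eqI[OF D])
  \<comment> \<open>The Lipschitz bound of the ball around \<open>x\<close> also holds on a smaller
    ball around \<open>y\<close>, so one constant controls the gradient at every point of the
    ball.\<close>
  have gK: "norm (g y) \<le> K x" if "y \<in> ball x (s x)" for x y
  proof (rule norm_gradient_le_of_local_Lipschitz[OF D _ K])
    show "0 < s x - dist x y" using that by simp
    show "\<bar>?f z - ?f y\<bar> \<le> K x * norm (z - y)" if z: "z \<in> ball y (s x - dist x y)" for z
    proof (rule lip)
      have "dist x z \<le> dist x y + dist y z" by (rule dist_triangle)
      then show "z \<in> ball x (s x)" using z by simp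
    qed fact
  qed
  have cover: "cbox 0 (\<chi> i. 2 * pi) \<subseteq> (\<Union>x\<in>UNIV. ball x (s x))"
  proof
    show "y \<in> (\<Union>x\<in>UNIV. ball x (s x))" for y :: "real ^ 'n"
      using s[of y] by (intro UN_I[of y]) simp_all
  qed
  obtain C where C: "finite C" "cbox 0 (\<chi> i. 2 * pi) \<subseteq> (\<Union>x\<in>C. ball x (s x))"
    by (rule compactE_image[OF compact_cbox _ cover]) (rule open_ball)
  have bound: "norm (torus_gradient Q p) \<le> (\<Sum>x\<in>C. K x)" for p
  proof -
    obtain y where y: "y \<in> cbox 0 (\<chi> i. 2 * pi)" "torus_of y = p" using torus_of_fundamental_cell by blast
    then obtain x where x: "x \<in> C" "y \<in> ball x (s x)" using C(2) by blast
    have "norm (torus_gradient Q p) \<le> K x" using gK[OF x(2)] grad[of y] y(2) by simp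
    also have "\<dots> \<le> (\<Sum>x\<in>C. K x)" by (rule member_le_sum) (use x C K in auto)
    finally show ?thesis .
  qed
  have le: "norm (torus_gradient Q p) \<le> max_gradient Q" for p
    unfolding max_gradient_def by (rule cSUP_upper) (use bound in \<open>auto intro!: bdd_aboveI\<close>)
  then show "0 \<le> max_gradient Q" by (meson norm_ge_zero order_trans)
  have "norm (?f x - ?f y) \<le> max_gradient Q * norm (x - y)"
  proof (rule differentiable_bound[where S = UNIV and f' = "\<lambda>x h. h \<bullet> g x"])
    show "(?f has_derivative (\<lambda>h. h \<bullet> g x)) (at x within UNIV)" for x using D[of x] by (simp add: gderiv_def)
    show "onorm (\<lambda>h. h \<bullet> g x) \<le> max_gradient Q" for x
    proof (rule onorm_le)
      show "norm (h \<bullet> g x) \<le> max_gradient Q * norm h" for h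
        using Cauchy_Schwarz_ineq2[of h "g x"] mult_left_mono[OF le[of "torus_of x"], of "norm h"]
        by (simp add: grad mult.commute)
    qed
  qed auto
  then show "\<bar>Q (torus_of x) - Q (torus_of y)\<bar> \<le> max_gradient Q * norm (x - y)" by simp
qed


section \<open>Weak derivatives and primitives\<close>

text \<open>Since \<open>v\<close> is merely integrable, its primitive need not be differentiable
  everywhere, and the product rule gives way to Fubini for \<open>v s * \<eta>' t\<close> on the
  triangle s <= t <= T. Integration over s produces the primitive of \<open>v\<close>, integration
  over t produces \<open>\<eta> T - \<eta> s\<close>.\<close>

lemma primitive_integration_by_parts:
  fixes v :: "real \<Rightarrow> real"
  assumes T: "0 \<le> T" and v: "v absolutely_integrable_on {0..T}"
    and \<eta>: "\<And>t. (\<eta> has_real_derivative \<eta>' t) (at t)" and \<eta>': "continuous_on UNIV \<eta>'"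
    and "\<eta> T = 0"
  shows "integral {0..T} (\<lambda>t. \<eta>' t * integral {0..t} v) = - integral {0..T} (\<lambda>t. \<eta> t * v t)"
proof -
  have "integrable lebesgue (\<lambda>s. indicator {0..T} s * v s)"
    using v by (simp add: set_integrable_def)
  then have "(\<lambda>s. indicator {0..T} s * v s) \<in> borel_measurable (completion lborel)"
    by simp
  \<comment> \<open>Fubini is applied to the product of Borel measures, whereas \<open>v\<close> is
    only Lebesgue measurable. It is replaced by a Borel function equal to it almost everywhere, cut
    off to \<open>{0..T}\<close>.\<close>
  then obtain g0 where g0: "g0 \<in> borel_measurable lborel"
    and ae0: "AE s in lborel. indicator {0..T} s * v s = g0 s"
    using completion_ex_borel_measurable_real by blast
  define g where "g s = indicator {0..T} s * g0 s" for s
  have g[measurable]: "g \<in> borel_measurable borel"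
    using g0 unfolding g_def by measurable
  have "AE s in lborel. indicator {0..T} s * v s = g s"
    using ae0
  proof eventually_elim
    case (elim s)
    then show ?case by (cases "s \<in> {0..T}") (auto simp: g_def)
  qed
  then have ae: "AE s in lebesgue. indicator {0..T} s * v s = g s"
    by (rule AE_completion)
  have gi: "integrable lebesgue g"
  proof (rule integrable_cong_AE_imp)
    show "integrable lebesgue (\<lambda>s. indicator {0..T} s * v s)" by fact
    show "g \<in> borel_measurable lebesgue" using g by (simp add: measurable_completion)
    show "AE s in lebesgue. indicator {0..T} s * v s = g s" by (rule ae)
  qed
  then have gi': "integrable lborel g"
    by (simp add: integrable_completion)
  define h where "h t = indicator {0..T} t * \<eta>' t" for t
  have h[measurable]: "h \<in> borel_measurable borel"
    unfolding h_def using \<eta>' by (intro borel_measurable_times) (auto intro: borel_measurable_continuous_onI)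
  have hi: "integrable lborel h"
  proof -
    have "integrable lborel (\<lambda>t. indicator {0..T} t *\<^sub>R \<eta>' t)"
      by (rule borel_integrable_compact) (auto intro: continuous_on_subset[OF \<eta>'])
    then show ?thesis by (simp add: h_def[abs_def])
  qed
  define F where "F s t = (if s \<le> t then g s * h t else 0)" for s t
  have Fm[measurable]: "case_prod F \<in> borel_measurable (lborel \<Otimes>\<^sub>M lborel)"
    unfolding F_def split_def by measurable
  have Fm'[measurable]: "(\<lambda>(t, s). F s t) \<in> borel_measurable (lborel \<Otimes>\<^sub>M lborel)"
    unfolding F_def split_def by measurable
  have Fi: "integrable (lborel \<Otimes>\<^sub>M lborel) (case_prod F)"
  proof (rule lborel_pair.Fubini_integrable)
    show "case_prod F \<in> borel_measurable (lborel \<Otimes>\<^sub>M lborel)" by (rule Fm)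
    have Fsi: "integrable lborel (F s)" for s
      unfolding F_def
      by (rule Bochner_Integration.integrable_bound[OF integrable_mult_right[OF hi, of "g s"]])
         (auto simp: abs_mult)
    then show "AE s in lborel. integrable lborel (\<lambda>t. case_prod F (s, t))" by simp
    have "integrable lborel (\<lambda>s. \<bar>g s\<bar> * (\<integral>t. \<bar>h t\<bar> \<partial>lborel))"
      using gi' by auto
    then show "integrable lborel (\<lambda>s. \<integral>t. norm (case_prod F (s, t)) \<partial>lborel)"
    proof (rule Bochner_Integration.integrable_bound)
      show "(\<lambda>s. \<integral>t. norm (case_prod F (s, t)) \<partial>lborel) \<in> borel_measurable lborel"
        by measurable
      have "norm (\<integral>t. norm (F s t) \<partial>lborel) \<le> norm (\<bar>g s\<bar> * (\<integral>t. \<bar>h t\<bar> \<partial>lborel))" for s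
      proof -
        have "(\<integral>t. norm (F s t) \<partial>lborel) \<le> (\<integral>t. \<bar>g s\<bar> * \<bar>h t\<bar> \<partial>lborel)"
        proof (rule integral_mono)
          show "integrable lborel (\<lambda>t. norm (F s t))" by (rule integrable_norm[OF Fsi])
          show "integrable lborel (\<lambda>t. \<bar>g s\<bar> * \<bar>h t\<bar>)" using hi by auto
        qed (auto simp: F_def abs_mult)
        moreover have "0 \<le> (\<integral>t. norm (F s t) \<partial>lborel)" by simp
        ultimately show ?thesis by simp
      qed
      then show "AE s in lborel. norm (\<integral>t. norm (case_prod F (s, t)) \<partial>lborel)
          \<le> norm (\<bar>g s\<bar> * (\<integral>t. \<bar>h t\<bar> \<partial>lborel))" by simp
    qed
  qed
  have inner1: "(\<integral>s. F s t \<partial>lborel) = h t * integral {0..t} v" if "t \<in> {0..T}" for t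
  proof -
    have "(\<integral>s. F s t \<partial>lborel) = (\<integral>s. h t * (indicator {0..t} s * g s) \<partial>lborel)"
      by (rule Bochner_Integration.integral_cong) (auto simp: F_def g_def indicator_def)
    also have "\<dots> = h t * (\<integral>s. indicator {0..t} s * g s \<partial>lborel)" by simp
    also have "(\<integral>s. indicator {0..t} s * g s \<partial>lborel) = (\<integral>s. indicator {0..t} s * g s \<partial>lebesgue)"
      by (rule integral_completion[symmetric]) measurable
    also have "\<dots> = (\<integral>s. indicator {0..t} s * v s \<partial>lebesgue)"
    proof (rule integral_cong_AE)
      show m: "(\<lambda>s. indicator {0..t} s * g s) \<in> borel_measurable lebesgue"
        by (intro measurable_completion) measurable
      have "set_integrable lebesgue {0..t} v"
        by (rule set_integrable_subset[OF v]) (use that in auto)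
      then show "(\<lambda>s. indicator {0..t} s * v s) \<in> borel_measurable lebesgue"
        by (auto simp: set_integrable_def)
      show "AE s in lebesgue. indicator {0..t} s * g s = indicator {0..t} s * v s"
        using ae by eventually_elim (use that in \<open>auto simp: indicator_def\<close>)
    qed
    also have "\<dots> = integral {0..t} v"
      using set_lebesgue_integral_eq_integral(2)[OF set_integrable_subset[OF v, of "{0..t}"]] that
      by (simp add: set_lebesgue_integral_def)
    finally show ?thesis .
  qed
  have inner2: "(\<integral>t. F s t \<partial>lborel) = - (\<eta> s * g s)" for s
  proof (cases "s \<in> {0..T}")
    case True
    have "(\<integral>t. F s t \<partial>lborel) = (\<integral>t. g s * (indicator {s..T} t *\<^sub>R \<eta>' t) \<partial>lborel)"
      using True by (intro Bochner_Integration.integral_cong) (auto simp: F_def h_def indicator_def)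
    also have "\<dots> = g s * (\<integral>t. indicator {s..T} t *\<^sub>R \<eta>' t \<partial>lborel)" by simp
    also have "(\<integral>t. indicator {s..T} t *\<^sub>R \<eta>' t \<partial>lborel) = \<eta> T - \<eta> s"
      using True
      by (intro integral_FTC_Icc)
         (auto intro: has_field_derivative_at_within[OF \<eta>] continuous_on_subset[OF \<eta>']
            simp: has_real_derivative_iff_has_vector_derivative[symmetric])
    finally show ?thesis using \<open>\<eta> T = 0\<close> by simp
  next
    case False
    then have "g s = 0" by (simp add: g_def)
    then show ?thesis by (simp add: F_def cong: if_cong)
  qed
  have inner0: "(\<integral>s. F s t \<partial>lborel) = 0" if "t \<notin> {0..T}" for t
  proof -
    have "h t = 0" using that by (simp add: h_def)
    then show ?thesis by (simp add: F_def cong: if_cong)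
  qed
  have \<eta>c: "continuous_on UNIV \<eta>"
    by (intro continuous_at_imp_continuous_on ballI DERIV_isCont[OF \<eta>])
  have ivc: "continuous_on {0..T} (\<lambda>t. integral {0..t} v)"
    by (rule indefinite_integral_continuous_1) (use v set_lebesgue_integral_eq_integral(1) in blast)
  have "integral {0..T} (\<lambda>t. \<eta>' t * integral {0..t} v)
     = (LINT t:{0..T}|lebesgue. \<eta>' t * integral {0..t} v)"
    by (rule set_lebesgue_integral_eq_integral(2)[symmetric])
       (intro absolutely_integrable_continuous_real continuous_intros ivc continuous_on_subset[OF \<eta>'], auto)
  also have "\<dots> = (LINT t|lebesgue. (\<integral>s. F s t \<partial>lborel))"
    unfolding set_lebesgue_integral_def
    by (rule Bochner_Integration.integral_cong) (use inner0 inner1 in \<open>auto simp: indicator_def h_def\<close>)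
  also have "\<dots> = (LINT t|lborel. (\<integral>s. F s t \<partial>lborel))"
    by (rule integral_completion) measurable
  also have "\<dots> = (LINT s|lborel. (\<integral>t. F s t \<partial>lborel))"
    by (rule lborel_pair.Fubini_integral[OF Fi])
  also have "\<dots> = (LINT s|lborel. - (\<eta> s * g s))" by (simp add: inner2)
  also have "\<dots> = (LINT s|lebesgue. - (\<eta> s * g s))"
    using borel_measurable_continuous_onI[OF \<eta>c, measurable]
    by (intro integral_completion[symmetric]) measurable
  also have "\<dots> = (LINT s|lebesgue. indicator {0..T} s *\<^sub>R - (\<eta> s * v s))"
  proof (rule integral_cong_AE)
    have m: "\<eta> \<in> borel_measurable lebesgue"
      using borel_measurable_continuous_onI[OF \<eta>c] by (intro measurable_completion) simp
    show "(\<lambda>s. - (\<eta> s * g s)) \<in> borel_measurable lebesgue"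
      using gi m by auto
    have "(\<lambda>s. \<eta> s * (indicator {0..T} s * v s)) \<in> borel_measurable lebesgue"
      using v by (intro borel_measurable_times[OF m]) (simp add: set_integrable_def borel_measurable_integrable)
    then show "(\<lambda>s. indicator {0..T} s *\<^sub>R - (\<eta> s * v s)) \<in> borel_measurable lebesgue"
      by (simp add: mult.left_commute)
    show "AE s in lebesgue. - (\<eta> s * g s) = indicator {0..T} s *\<^sub>R - (\<eta> s * v s)"
      using ae by eventually_elim (auto simp: indicator_def split: if_splits)
  qed
  also have "\<dots> = (LINT s:{0..T}|lebesgue. - (\<eta> s * v s))"
    by (simp add: set_lebesgue_integral_def)
  also have "\<dots> = integral {0..T} (\<lambda>s. - (\<eta> s * v s))"
  proof (rule set_lebesgue_integral_eq_integral(2))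
    have "(\<lambda>s. \<eta> s * v s) absolutely_integrable_on {0..T}"
      by (intro absolutely_integrable_bounded_measurable_product_real v
          absolutely_integrable_imp_borel_measurable absolutely_integrable_continuous_real
          continuous_on_subset[OF \<eta>c] compact_imp_bounded compact_continuous_image) auto
    then show "(\<lambda>s. - (\<eta> s * v s)) absolutely_integrable_on {0..T}"
      by (simp add: set_integrable_def)
  qed
  also have "\<dots> = - integral {0..T} (\<lambda>t. \<eta> t * v t)" by simp
  finally show ?thesis .
qed

lemma continuous_on_atLeastI:
  fixes f :: "real \<Rightarrow> 'a::topological_space"
  assumes "\<And>b. a \<le> b \<Longrightarrow> continuous_on {a..b} f"
  shows "continuous_on {a..} f"
proof (clarsimp simp: continuous_on_eq_continuous_within)
  fix x assume "a \<le> x"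
  then have "continuous (at x within {a..x+1}) f"
    using assms[of "x + 1"] by (simp add: continuous_on_eq_continuous_within)
  moreover have "at x within {a..} = at x within {a..x+1}"
    by (rule at_within_nhd[of x "{..<x+1}"]) auto
  ultimately show "continuous (at x within {a..}) f" by simp
qed

lemma LINT_Ioo_eq_integral:
  fixes f :: "real \<Rightarrow> 'a::euclidean_space"
  assumes "f absolutely_integrable_on {a..b}"
  shows "(LINT t:{a<..<b}|lebesgue. f t) = integral {a..b} f"
  using assms set_lebesgue_integral_eq_integral(2)[where f = f and S = "{a<..<b}"]
  by (simp add: absolutely_integrable_on_Icc_iff_Ioo integral_open_interval_real)

text \<open>On a bounded interval square integrability implies integrability, through |v| <= 1 +
  |v|^2. The right side is in the language of gauge integrals on closed intervals, which combine
  well.\<close>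

lemma L2_on_iff:
  fixes v :: "real \<Rightarrow> real ^ 'n"
  shows "L2_on {0<..<T} v \<longleftrightarrow>
    v absolutely_integrable_on {0..T} \<and> (\<lambda>t. (norm (v t))\<^sup>2) integrable_on {0..T}"
proof
  assume *: "L2_on {0<..<T} v"
  then have sq: "(\<lambda>t. (norm (v t))\<^sup>2) absolutely_integrable_on {0<..<T}"
    by (simp add: L2_on_def)
  have "v absolutely_integrable_on {0<..<T}"
  proof (rule measurable_bounded_by_integrable_imp_absolutely_integrable)
    show "v \<in> borel_measurable (lebesgue_on {0<..<T})" using * by (simp add: L2_on_def)
    show "(\<lambda>t. 1 + (norm (v t))\<^sup>2) integrable_on {0<..<T}"
      using sq by (intro integrable_add set_lebesgue_integral_eq_integral(1)[OF sq]) (simp add: integrable_on_open_interval_real integrable_continuous_real)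
    show "norm (v t) \<le> 1 + (norm (v t))\<^sup>2" for t
    proof -
      have "0 \<le> (norm (v t) - 1/2)\<^sup>2" by simp
      then show ?thesis by (simp add: power2_eq_square algebra_simps)
    qed
  qed auto
  then show "v absolutely_integrable_on {0..T} \<and> (\<lambda>t. (norm (v t))\<^sup>2) integrable_on {0..T}"
    using sq set_lebesgue_integral_eq_integral(1)[OF sq[folded absolutely_integrable_on_Icc_iff_Ioo]]
    by (simp add: absolutely_integrable_on_Icc_iff_Ioo)
next
  assume *: "v absolutely_integrable_on {0..T} \<and> (\<lambda>t. (norm (v t))\<^sup>2) integrable_on {0..T}"
  then have "v absolutely_integrable_on {0<..<T}" using absolutely_integrable_on_Icc_iff_Ioo by blast
  moreover have "(\<lambda>t. (norm (v t))\<^sup>2) absolutely_integrable_on {0..T}"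
    using * by (intro nonnegative_absolutely_integrable_1) auto
  ultimately show "L2_on {0<..<T} v"
    unfolding L2_on_def using absolutely_integrable_on_Icc_iff_Ioo
      absolutely_integrable_imp_borel_measurable[where f = v and S = "{0<..<T}"]
    by (metis lmeasurable_box box_real(1) fmeasurableD)
qed

lemma absolutely_integrable_bounded_mult:
  fixes v :: "real \<Rightarrow> 'a::euclidean_space"
  assumes "continuous_on {a..b} \<eta>" "v absolutely_integrable_on {a..b}"
  shows "(\<lambda>t. \<eta> t *\<^sub>R v t) absolutely_integrable_on {a..b}"
proof (rule absolutely_integrable_bounded_measurable_product[OF bilinear_conv_bounded_bilinear[THEN iffD2, OF bounded_bilinear_scaleR]])
  show "\<eta> \<in> borel_measurable (lebesgue_on {a..b})"
    using assms(1) by (intro absolutely_integrable_imp_borel_measurable absolutely_integrable_continuous_real) auto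
  show "bounded (\<eta> ` {a..b})"
    using assms(1) by (intro compact_imp_bounded compact_continuous_image) auto
qed (use assms in auto)

lemma absolutely_integrable_vec_nth:
  fixes v :: "real \<Rightarrow> real ^ 'n"
  assumes "v absolutely_integrable_on S"
  shows "(\<lambda>t. v t $ k) absolutely_integrable_on S"
  using absolutely_integrable_linear[OF assms bounded_linear_vec_nth[of k]] by (simp add: o_def)

lemma integral_vec_nth:
  fixes v :: "real \<Rightarrow> real ^ 'n"
  assumes "v integrable_on S"
  shows "integral S v $ k = integral S (\<lambda>t. v t $ k)"
  using integral_linear[OF assms bounded_linear_vec_nth[of k]] by (simp add: o_def)

text \<open>Componentwise this is the scalar integration by parts; the constant
  \<open>\<phi> 0\<close> contributes nothing because \<open>\<eta>\<close> vanishes at both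
  ends.\<close>

lemma weak_derivative_on_primitive:
  fixes v :: "real \<Rightarrow> real ^ 'n"
  assumes "0 < T" and v: "v absolutely_integrable_on {0..T}"
    and \<phi>: "\<And>t. t \<in> {0..T} \<Longrightarrow> \<phi> t = \<phi> 0 + integral {0..t} v"
  shows "weak_derivative_on T \<phi> v"
  unfolding weak_derivative_on_def
proof (intro allI impI)
  fix \<eta> \<eta>' assume "test_function T \<eta> \<eta>'"
  then obtain a b where d: "\<And>t. (\<eta> has_real_derivative \<eta>' t) (at t)" and c: "continuous_on UNIV \<eta>'"
    and ab: "0 < a" "a \<le> b" "b < T" and z: "\<And>t. t \<notin> {a..b} \<Longrightarrow> \<eta> t = 0"
    unfolding test_function_def by blast
  have \<eta>0: "\<eta> 0 = 0" "\<eta> T = 0" using ab by (auto intro!: z)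
  have \<eta>c: "continuous_on S \<eta>" for S
    by (intro continuous_at_imp_continuous_on ballI DERIV_isCont[OF d])
  have \<eta>'c: "continuous_on S \<eta>'" for S using c continuous_on_subset by blast
  have vi: "v integrable_on {0..T}" using v set_lebesgue_integral_eq_integral(1) by blast
  have \<phi>c: "continuous_on {0..T} \<phi>"
    by (subst continuous_on_cong[OF refl \<phi>]) (auto intro!: continuous_intros indefinite_integral_continuous_1 vi)
  have A: "(\<lambda>t. \<eta>' t *\<^sub>R \<phi> t) absolutely_integrable_on {0..T}"
    by (intro absolutely_integrable_continuous_real continuous_intros \<phi>c \<eta>'c)
  have B: "(\<lambda>t. \<eta> t *\<^sub>R v t) absolutely_integrable_on {0..T}"
    by (intro absolutely_integrable_bounded_mult \<eta>c v)
  have "integral {0..T} (\<lambda>t. \<eta>' t *\<^sub>R \<phi> t) $ k = (- integral {0..T} (\<lambda>t. \<eta> t *\<^sub>R v t)) $ k" for k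
  proof -
    have vk: "(\<lambda>t. v t $ k) absolutely_integrable_on {0..T}"
      by (rule absolutely_integrable_vec_nth[OF v])
    have ik: "(\<lambda>t. v t $ k) integrable_on {0..T}" using vk set_lebesgue_integral_eq_integral(1) by blast
    have \<phi>k: "\<phi> t $ k = \<phi> 0 $ k + integral {0..t} (\<lambda>s. v s $ k)" if "t \<in> {0..T}" for t
    proof -
      have "v integrable_on {0..t}" by (rule integrable_subinterval_real[OF vi]) (use that in auto)
      then show ?thesis by (subst \<phi>[OF that]) (simp only: vector_add_component integral_vec_nth)
    qed
    have "((\<lambda>t. \<eta>' t * \<phi> 0 $ k) has_integral (\<eta> T * \<phi> 0 $ k - \<eta> 0 * \<phi> 0 $ k)) {0..T}"
      using \<open>0 < T\<close>
      by (intro fundamental_theorem_of_calculus)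
         (auto intro!: derivative_eq_intros has_field_derivative_at_within[OF d]
            simp: has_real_derivative_iff_has_vector_derivative[symmetric])
    then have 0: "((\<lambda>t. \<eta>' t * \<phi> 0 $ k) has_integral 0) {0..T}" by (simp add: \<eta>0)
    have cc: "continuous_on {0..T} (\<lambda>t. \<eta>' t * integral {0..t} (\<lambda>s. v s $ k))"
      by (intro continuous_intros \<eta>'c indefinite_integral_continuous_1 ik)
    have "integral {0..T} (\<lambda>t. \<eta>' t *\<^sub>R \<phi> t) $ k = integral {0..T} (\<lambda>t. \<eta>' t * \<phi> t $ k)"
      using A by (subst integral_vec_nth) (auto dest: set_lebesgue_integral_eq_integral(1))
    also have "\<dots> = integral {0..T} (\<lambda>t. \<eta>' t * \<phi> 0 $ k + \<eta>' t * integral {0..t} (\<lambda>s. v s $ k))"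
      by (rule Henstock_Kurzweil_Integration.integral_cong) (subst \<phi>k, simp_all add: distrib_left)
    also have "\<dots> = integral {0..T} (\<lambda>t. \<eta>' t * integral {0..t} (\<lambda>s. v s $ k))"
      by (subst Henstock_Kurzweil_Integration.integral_add[OF has_integral_integrable[OF 0] integrable_continuous_real[OF cc]])
         (simp only: integral_unique[OF 0] add_0_left)
    also have "\<dots> = - integral {0..T} (\<lambda>t. \<eta> t * v t $ k)"
      using \<open>0 < T\<close> by (intro primitive_integration_by_parts vk d c \<eta>0) simp
    also have "\<dots> = (- integral {0..T} (\<lambda>t. \<eta> t *\<^sub>R v t)) $ k"
      using B by (simp add: integral_vec_nth set_lebesgue_integral_eq_integral(1))
    finally show ?thesis .
  qed
  then show "(LINT t:{0<..<T}|lebesgue. \<eta>' t *\<^sub>R \<phi> t) = - (LINT t:{0<..<T}|lebesgue. \<eta> t *\<^sub>R v t)"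
    by (simp add: LINT_Ioo_eq_integral A B vec_eq_iff)
qed

text \<open>The test function used has derivative \<open>\<rho> (w - c)\<close>, where \<open>c\<close> is the \<open>\<rho>\<close>-average of
  \<open>w\<close>; this forces \<open>\<integral> \<rho> (w - c)\<^sup>2 = 0\<close>.\<close>
lemma du_Bois_Reymond:
  fixes w :: "real \<Rightarrow> real"
  assumes w: "continuous_on {0..} w" and "0 < a" "a < b" "b < T"
    and orth: "\<And>\<eta> \<eta>'. test_function T \<eta> \<eta>' \<Longrightarrow> integral {0..T} (\<lambda>t. \<eta>' t * w t) = 0"
  shows "\<exists>c. \<forall>t\<in>{a<..<b}. w t = c"
proof -
  \<comment> \<open>Constant continuation of \<open>w\<close> to negative times: it is continuous on
    the whole line and agrees with \<open>w\<close> on the interval of interest.\<close>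
  define W where "W t = w (max 0 t)" for t
  have W: "continuous_on S W" for S
    unfolding W_def by (rule continuous_on_compose2[OF w]) (auto intro!: continuous_intros)
  define \<rho> where "\<rho> t = max 0 ((t - a) * (b - t))" for t
  have \<rho>: "continuous_on S \<rho>" for S unfolding \<rho>_def by (intro continuous_intros)
  have \<rho>0: "0 \<le> \<rho> t" for t by (simp add: \<rho>_def)
  have \<rho>pos: "0 < \<rho> t" if "t \<in> {a<..<b}" for t using that by (simp add: \<rho>_def)
  have \<rho>z: "\<rho> t = 0" if "t \<notin> {a<..<b}" for t
  proof -
    have "(t - a) * (b - t) \<le> 0"
      using that \<open>a < b\<close> by (cases "t \<le> a") (auto simp: mult_le_0_iff)
    then show ?thesis by (simp add: \<rho>_def)
  qed
  define m where "m = integral {a..b} \<rho>"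
  have "m \<noteq> 0"
    unfolding m_def using integral_eq_0_iff[OF \<rho> \<open>a < b\<close> \<rho>0] \<rho>pos[of "(a + b) / 2"] \<open>a < b\<close> by force
  define c where "c = integral {a..b} (\<lambda>t. \<rho> t * W t) / m"
  define g where "g t = \<rho> t * (W t - c)" for t
  have gc: "continuous_on S g" for S unfolding g_def by (intro continuous_intros \<rho> W)
  have gz: "g t = 0" if "t \<notin> {a<..<b}" for t by (simp add: g_def \<rho>z[OF that])
  have g_integral: "integral {a..b} g = 0"
  proof -
    have "integral {a..b} g = integral {a..b} (\<lambda>t. \<rho> t * W t) - integral {a..b} (\<lambda>t. \<rho> t * c)"
      unfolding g_def right_diff_distrib
      by (intro Henstock_Kurzweil_Integration.integral_diff integrable_continuous_real continuous_intros \<rho> W)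
    then show ?thesis using \<open>m \<noteq> 0\<close> by (simp add: m_def c_def)
  qed
  have extend: "integral {x..y} h = integral {a..b} h"
    if "x \<le> a" "b \<le> y" "continuous_on UNIV h" "\<And>t. t \<notin> {a<..<b} \<Longrightarrow> h t = 0" for x y and h :: "real \<Rightarrow> real"
    by (rule integral_spike_set) (use that in \<open>auto intro!: negligible_subset[OF negligible_empty]\<close>)
  \<comment> \<open>The lower limit -1 lies left of the support of \<open>g\<close>. Every t >= a is
    thus interior to \<open>{-1..t + 1}\<close>, which makes the derivative two-sided, and left of
    \<open>a\<close> the function vanishes.\<close>
  define \<eta> where "\<eta> t = integral {-1..t} g" for t
  have \<eta>a: "\<eta> t = 0" if "t \<le> a" for t
  proof -
    have "integral {-1..t} g = integral {-1..t} (\<lambda>_. 0)"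
      using that by (intro Henstock_Kurzweil_Integration.integral_cong gz) auto
    then show ?thesis by (simp add: \<eta>_def)
  qed
  have "test_function T \<eta> g"
    unfolding test_function_def
  proof (intro conjI allI exI impI)
    show "(\<eta> has_real_derivative g t) (at t)" for t
    proof (cases "t < a")
      case True
      have "(\<eta> has_real_derivative 0) (at t)"
      proof (subst DERIV_cong_ev[OF refl _ refl, of _ "\<lambda>_. 0"])
        show "\<forall>\<^sub>F x in nhds t. \<eta> x = 0"
          using eventually_nhds_in_open[of "{..<a}" t] True by (auto elim!: eventually_mono intro!: \<eta>a)
      qed simp
      then show ?thesis using True by (simp add: gz)
    next
      case False
      then have "t \<in> {-1..t + 1}" using \<open>0 < a\<close> by auto
      then have "(\<eta> has_real_derivative g t) (at t within {-1..t+1})"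
        unfolding \<eta>_def by (rule integral_has_real_derivative[OF gc])
      moreover have "at t within {-1..t+1} = at t"
        using False \<open>0 < a\<close> by (intro at_within_interior) auto
      ultimately show ?thesis by simp
    qed
    show "continuous_on UNIV g" by (rule gc)
    show "0 < a" "a \<le> b" "b < T" using assms by auto
    show "\<eta> t = 0" if "t \<notin> {a..b}" for t
    proof (cases "t < a")
      case True then show ?thesis by (simp add: \<eta>a)
    next
      case False
      then have "b \<le> t" using that by auto
      then show ?thesis unfolding \<eta>_def
        using extend[OF _ _ gc gz, of "-1" t] g_integral \<open>0 < a\<close> by simp
    qed
  qed
  then have "integral {0..T} (\<lambda>t. g t * w t) = 0" by (rule orth)
  also have "integral {0..T} (\<lambda>t. g t * w t) = integral {0..T} (\<lambda>t. g t * W t)"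
    by (rule Henstock_Kurzweil_Integration.integral_cong) (simp add: W_def)
  also have "\<dots> = integral {a..b} (\<lambda>t. g t * W t)"
    using assms by (intro extend continuous_intros gc W) (auto simp: gz)
  finally have gW: "integral {a..b} (\<lambda>t. g t * W t) = 0" .
  have "integral {a..b} (\<lambda>t. g t * (W t - c)) = integral {a..b} (\<lambda>t. g t * W t) - integral {a..b} (\<lambda>t. g t * c)"
    unfolding right_diff_distrib
    by (intro Henstock_Kurzweil_Integration.integral_diff integrable_continuous_real continuous_intros gc W)
  then have 0: "integral {a..b} (\<lambda>t. g t * (W t - c)) = 0" using gW g_integral by simp
  have "\<forall>t\<in>{a..b}. g t * (W t - c) = 0"
    by (rule integral_eq_0_iff[THEN iffD1, OF _ \<open>a < b\<close> _ 0])
       (auto intro!: continuous_intros \<rho> W simp: g_def mult.assoc \<rho>0)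
  then have gWc: "g t * (W t - c) = 0" if "t \<in> {a<..<b}" for t
    using that by (meson greaterThanLessThan_subseteq_atLeastAtMost_iff order_refl subsetD)
  have "W t = c" if "t \<in> {a<..<b}" for t
    using gWc[OF that] \<rho>pos[OF that] by (simp add: g_def)
  then have "\<forall>t\<in>{a<..<b}. w t = c" using \<open>0 < a\<close> by (auto simp: W_def max_def split: if_splits)
  then show ?thesis by blast
qed

text \<open>Componentwise, the difference of \<open>\<phi>\<close> and the primitive of
  \<open>v\<close> integrates to zero against the derivative of every test function. By du
  Bois-Reymond it is constant on each bounded interval compactly inside the open half-line, hence on
  the half-line, and by continuity also at 0.\<close>

lemma weak_derivative_imp_primitive:
  fixes v :: "real \<Rightarrow> real ^ 'n"
  assumes \<phi>: "continuous_on {0..} \<phi>" and v: "\<And>T. 0 < T \<Longrightarrow> v absolutely_integrable_on {0..T}"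
    and weak: "\<And>T. 0 < T \<Longrightarrow> weak_derivative_on T \<phi> v"
    and "0 \<le> t"
  shows "\<phi> t = \<phi> 0 + integral {0..t} v"
proof -
  have vi: "v integrable_on {0..T}" for T
  proof (cases "0 < T")
    case True
    then show ?thesis using set_lebesgue_integral_eq_integral(1)[OF v[of T]] by simp
  next
    case False
    then have "{0..T} = {} \<or> {0..T} = {0}" by auto
    then show ?thesis by (auto intro: integrable_on_refl[where 'a=real, unfolded box_real])
  qed
  have "\<phi> t $ k - integral {0..t} (\<lambda>s. v s $ k) = \<phi> 0 $ k" for k
  proof -
    define w where "w t = \<phi> t $ k - integral {0..t} (\<lambda>s. v s $ k)" for t
    have vk: "(\<lambda>s. v s $ k) absolutely_integrable_on {0..T}" if "0 < T" for T
      by (rule absolutely_integrable_vec_nth[OF v[OF that]])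
    have vki: "(\<lambda>s. v s $ k) integrable_on {0..T}" if "0 < T" for T
      using vk[OF that] set_lebesgue_integral_eq_integral(1) by blast
    have w: "continuous_on {0..} w"
    proof (rule continuous_on_atLeastI)
      show "continuous_on {0..b} w" if "0 \<le> b" for b
        unfolding w_def
        by (intro continuous_intros indefinite_integral_continuous_1 integrable_subinterval_real[OF vki[of "b + 1"]]
              continuous_on_subset[OF \<phi>]) (use that in auto)
    qed
    have orth: "integral {0..T} (\<lambda>t. \<eta>' t * w t) = 0" if "0 < T" "test_function T \<eta> \<eta>'" for T \<eta> \<eta>'
    proof -
      from \<open>test_function T \<eta> \<eta>'\<close>
      obtain a b where d: "\<And>t. (\<eta> has_real_derivative \<eta>' t) (at t)" and c: "continuous_on UNIV \<eta>'"
        and ab: "0 < a" "a \<le> b" "b < T" and z: "\<And>t. t \<notin> {a..b} \<Longrightarrow> \<eta> t = 0"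
        unfolding test_function_def by blast
      have \<eta>T: "\<eta> T = 0" using ab by (auto intro!: z)
      have \<eta>c: "continuous_on S \<eta>" for S
        by (intro continuous_at_imp_continuous_on ballI DERIV_isCont[OF d])
      have \<eta>'c: "continuous_on S \<eta>'" for S using c continuous_on_subset by blast
      have \<phi>c: "continuous_on {0..T} \<phi>" using \<phi> continuous_on_subset by fastforce
      have A: "(\<lambda>t. \<eta>' t *\<^sub>R \<phi> t) absolutely_integrable_on {0..T}"
        by (intro absolutely_integrable_continuous_real continuous_intros \<phi>c \<eta>'c)
      have B: "(\<lambda>t. \<eta> t *\<^sub>R v t) absolutely_integrable_on {0..T}"
        by (intro absolutely_integrable_bounded_mult \<eta>c v \<open>0 < T\<close>)
      have "integral {0..T} (\<lambda>t. \<eta>' t *\<^sub>R \<phi> t) = - integral {0..T} (\<lambda>t. \<eta> t *\<^sub>R v t)"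
        using weak[OF \<open>0 < T\<close>, unfolded weak_derivative_on_def, rule_format, OF that(2)]
        unfolding LINT_Ioo_eq_integral[OF A] LINT_Ioo_eq_integral[OF B] .
      then have "integral {0..T} (\<lambda>t. \<eta>' t *\<^sub>R \<phi> t) $ k = - integral {0..T} (\<lambda>t. \<eta> t *\<^sub>R v t) $ k"
        by simp
      then have "integral {0..T} (\<lambda>t. \<eta>' t * \<phi> t $ k) = - integral {0..T} (\<lambda>t. \<eta> t * v t $ k)"
        using A B by (simp add: integral_vec_nth set_lebesgue_integral_eq_integral(1))
      also have "\<dots> = integral {0..T} (\<lambda>t. \<eta>' t * integral {0..t} (\<lambda>s. v s $ k))"
        using \<open>0 < T\<close> by (intro primitive_integration_by_parts[symmetric] vk d c \<eta>T) auto
      finally show ?thesis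
        unfolding w_def right_diff_distrib using \<open>0 < T\<close>
        by (subst Henstock_Kurzweil_Integration.integral_diff)
           (auto intro!: integrable_continuous_real continuous_intros \<eta>'c \<phi>c indefinite_integral_continuous_1 vki)
    qed
    have const: "w s = w 1" if "0 < s" for s
    proof -
      \<comment> \<open>An interval containing both \<open>s\<close> and 1, so that all local
        constants equal the value at time 1.\<close>
      define a b where "a = min s 1 / 2" and "b = max s 1 + 1"
      have ab: "0 < a" "a < b" "b < b + 1" "s \<in> {a<..<b}" "1 \<in> {a<..<b}"
        using that by (auto simp: a_def b_def min_def max_def)
      have "\<exists>c. \<forall>t\<in>{a<..<b}. w t = c"
      proof (rule du_Bois_Reymond[OF w ab(1-3)])
        show "integral {0..b + 1} (\<lambda>t. \<eta>' t * w t) = 0" if "test_function (b + 1) \<eta> \<eta>'" for \<eta> \<eta>'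
          using ab that by (intro orth[of "b + 1"]) auto
      qed
      then obtain c where "\<forall>t\<in>{a<..<b}. w t = c" by blast
      then show ?thesis using ab by metis
    qed
    have const0: "w s = w 1" if "0 \<le> s" for s
    proof (rule continuous_constant_on_closure[of "{0<..}" w])
      show "continuous_on (closure {0<..}) w" using w by simp
      show "w x = w 1" if "x \<in> {0<..}" for x using const[of x] that by simp
      show "s \<in> closure {0<..}" using that by simp
    qed
    have "w t = w 0" using const0[OF \<open>0 \<le> t\<close>] const0[of 0] by simp
    then show ?thesis by (simp add: w_def)
  qed
  then have "\<phi> t $ k = (\<phi> 0 + integral {0..t} v) $ k" for k
    by (simp add: integral_vec_nth[OF vi] algebra_simps)
  then show ?thesis by (simp add: vec_eq_iff)
qed

text \<open>Lebesgue differentiation: almost everywhere \<open>u\<close> is the limit of its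
  averages over short intervals to the right, and these averages are differences of the vanishing
  primitive. Extension by zero makes the function integrable on every interval of the line.\<close>

lemma negligible_of_zero_primitive:
  fixes u :: "real \<Rightarrow> 'a::euclidean_space"
  assumes u: "\<And>T. u integrable_on {0..T}" and 0: "\<And>T. 0 \<le> T \<Longrightarrow> integral {0..T} u = 0"
  obtains N where "negligible N" "\<And>t. 0 \<le> t \<Longrightarrow> t \<notin> N \<Longrightarrow> u t = 0"
proof -
  define f where "f t = (if t \<in> {0..} then u t else 0)" for t
  have f: "f integrable_on {a..b}" for a b
    unfolding f_def integrable_restrict_Int using integrable_subinterval_real[OF u[of b], of "max 0 a" b]
    by (simp add: Int_atLeastAtMost)
  obtain N where N: "negligible N"
    "\<And>x e. \<lbrakk>x \<notin> N; 0 < e\<rbrakk> \<Longrightarrow> \<exists>d>0. \<forall>h. 0 < h \<and> h < d \<longrightarrow>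
       norm (integral (cbox x (x + h *\<^sub>R One)) f /\<^sub>R h ^ DIM(real) - f x) < e"
    using integrable_ccontinuous_explicit[of f] f by (metis box_real(2))
  have "u t = 0" if t: "0 \<le> t" "t \<notin> N" for t
  proof (rule ccontr)
    assume "u t \<noteq> 0"
    then obtain d where d: "d > 0" "\<And>h. 0 < h \<and> h < d \<Longrightarrow>
       norm (integral (cbox t (t + h *\<^sub>R One)) f /\<^sub>R h ^ DIM(real) - f t) < norm (u t)"
      using N(2)[OF t(2), of "norm (u t)"] by auto
    have "integral {t..t+d/2} f = integral {t..t+d/2} u"
      by (rule Henstock_Kurzweil_Integration.integral_cong) (use t in \<open>auto simp: f_def\<close>)
    also have "\<dots> = integral {0..t+d/2} u - integral {0..t} u"
      using Henstock_Kurzweil_Integration.integral_combine[of 0 t "t+d/2" u] t d(1) u by (simp add: algebra_simps)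
    also have "\<dots> = 0" using 0 t d(1) by simp
    finally show False using d(2)[of "d/2"] d(1) t by (simp add: f_def)
  qed
  then show ?thesis using that N(1) by blast
qed


section \<open>Lifts of curves\<close>

text \<open>The absolutely continuous description of H1: \<open>\<phi>\<close> is a primitive of a
  locally square integrable \<open>v\<close>. Being stated by integrals over \<open>{0..T}\<close>,
  it passes easily to shifted and concatenated curves.\<close>

definition h1_lift :: "(real \<Rightarrow> real ^ 'n::finite) \<Rightarrow> (real \<Rightarrow> real ^ 'n) \<Rightarrow> bool" where
  "h1_lift \<phi> v \<longleftrightarrow> (\<forall>T\<ge>0. v absolutely_integrable_on {0..T} \<and>
     (\<lambda>t. (norm (v t))\<^sup>2) integrable_on {0..T} \<and> \<phi> T = \<phi> 0 + integral {0..T} v)"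

lemma h1_liftD:
  assumes "h1_lift \<phi> v" "0 \<le> T"
  shows "v absolutely_integrable_on {0..T}" "v integrable_on {0..T}"
    "(\<lambda>t. (norm (v t))\<^sup>2) integrable_on {0..T}" "\<phi> T = \<phi> 0 + integral {0..T} v"
  using assms set_lebesgue_integral_eq_integral(1) unfolding h1_lift_def by blast+

lemma h1_lift_continuous:
  assumes "h1_lift \<phi> v"
  shows "continuous_on {0..} \<phi>"
proof (rule continuous_on_atLeastI)
  fix b :: real assume "0 \<le> b"
  have "continuous_on {0..b} (\<lambda>T. \<phi> 0 + integral {0..T} v)"
    using \<open>0 \<le> b\<close> by (intro continuous_intros indefinite_integral_continuous_1 h1_liftD(2)[OF assms])
  then show "continuous_on {0..b} \<phi>"
  proof (rule continuous_on_eq)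
    show "\<phi> 0 + integral {0..T} v = \<phi> T" if "T \<in> {0..b}" for T
      using h1_liftD(4)[OF assms, of T, symmetric] that by simp
  qed
qed

lemma h1_lift_increment:
  assumes "h1_lift \<phi> v" "0 \<le> s" "s \<le> t"
  shows "\<phi> t - \<phi> s = integral {s..t} v"
proof -
  have "integral {0..s} v + integral {s..t} v = integral {0..t} v"
    using assms by (intro Henstock_Kurzweil_Integration.integral_combine h1_liftD(2)[OF assms(1)]) auto
  then show ?thesis
    using h1_liftD(4)[OF assms(1,2)] h1_liftD(4)[OF assms(1), of t] assms by (simp add: algebra_simps)
qed

text \<open>Combines the two directions between weak derivatives and primitives. From here on weak
  derivatives no longer occur.\<close>

lemma is_velocity_iff_h1_lift:
  "is_velocity \<Phi> v \<longleftrightarrow> (\<exists>\<phi>. h1_lift \<phi> v \<and> (\<forall>t\<ge>0. \<Phi> t = torus_of (\<phi> t)))"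
proof
  assume "is_velocity \<Phi> v"
  then obtain \<phi> where \<phi>: "continuous_on {0..} \<phi>" "\<forall>t\<ge>0. \<Phi> t = torus_of (\<phi> t)"
    and v: "\<And>T. 0 < T \<Longrightarrow> L2_on {0<..<T} v" "\<And>T. 0 < T \<Longrightarrow> weak_derivative_on T \<phi> v"
    unfolding is_velocity_def by blast
  have int: "v absolutely_integrable_on {0..T}" "(\<lambda>t. (norm (v t))\<^sup>2) integrable_on {0..T}" if "0 < T" for T
    using v(1)[OF that] L2_on_iff by blast+
  \<comment> \<open>The definition speaks of positive horizons; restricting from
    \<open>T + 1\<close> includes T = 0.\<close>
  have "v absolutely_integrable_on {0..T}" "(\<lambda>t. (norm (v t))\<^sup>2) integrable_on {0..T}" if "0 \<le> T" for T
    using int[of "T + 1"] that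
    by (auto intro: absolutely_integrable_on_subinterval integrable_subinterval_real)
  moreover have "\<phi> T = \<phi> 0 + integral {0..T} v" if "0 \<le> T" for T
    by (rule weak_derivative_imp_primitive[OF \<phi>(1) int(1) v(2) that])
  ultimately show "\<exists>\<phi>. h1_lift \<phi> v \<and> (\<forall>t\<ge>0. \<Phi> t = torus_of (\<phi> t))"
    unfolding h1_lift_def using \<phi>(2) by blast
next
  assume "\<exists>\<phi>. h1_lift \<phi> v \<and> (\<forall>t\<ge>0. \<Phi> t = torus_of (\<phi> t))"
  then obtain \<phi> where \<phi>: "h1_lift \<phi> v" "\<forall>t\<ge>0. \<Phi> t = torus_of (\<phi> t)" by blast
  have "weak_derivative_on T \<phi> v" "L2_on {0<..<T} v" if "0 < T" for T
  proof -
    have "0 \<le> T" using that by simp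
    note T = h1_liftD[OF \<phi>(1) this]
    show "weak_derivative_on T \<phi> v"
      by (rule weak_derivative_on_primitive[OF that T(1)]) (rule h1_liftD(4)[OF \<phi>(1)], simp)
    show "L2_on {0<..<T} v" unfolding L2_on_iff using T(1,3) by (rule conjI)
  qed
  then show "is_velocity \<Phi> v"
    unfolding is_velocity_def using \<phi> h1_lift_continuous by blast
qed

lemma h1_lift_translate:
  assumes "h1_lift \<phi> v"
  shows "h1_lift (\<lambda>t. \<phi> t + c) v"
  unfolding h1_lift_def
proof (intro allI impI conjI)
  fix T :: real assume "0 \<le> T"
  note T = h1_liftD[OF assms this]
  show "v absolutely_integrable_on {0..T}" "(\<lambda>t. (norm (v t))\<^sup>2) integrable_on {0..T}" by (rule T)+
  show "\<phi> T + c = \<phi> 0 + c + integral {0..T} v" using T(4) by (metis add.assoc add.commute)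
qed

text \<open>Each component of the difference is continuous with values in the lattice 2 pi Z.
  Distinct values are at least 2 pi apart, so it is constant on the connected half-line.\<close>

lemma torus_lift_difference_constant:
  fixes \<phi> \<psi> :: "real \<Rightarrow> real ^ 'n::finite"
  assumes \<phi>: "continuous_on {0..} \<phi>" and \<psi>: "continuous_on {0..} \<psi>"
    and eq: "\<And>t. 0 \<le> t \<Longrightarrow> torus_of (\<phi> t) = torus_of (\<psi> t)" and "0 \<le> t"
  shows "\<phi> t - \<psi> t = \<phi> 0 - \<psi> 0"
proof -
  have "(\<phi> t - \<psi> t) $ i = (\<phi> 0 - \<psi> 0) $ i" for i
  proof -
    let ?d = "\<lambda>t. (\<phi> t - \<psi> t) $ i"
    have lattice: "\<exists>k::int. ?d t = 2 * pi * of_int k" if "0 \<le> t" for t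
      using eq[OF that] by (simp add: torus_of_eq_iff)
    have "?d constant_on {0..}"
    proof (rule continuous_discrete_range_constant)
      show "continuous_on {0..} ?d" by (intro continuous_intros \<phi> \<psi>)
      fix s :: real assume "s \<in> {0..}"
      show "\<exists>e>0. \<forall>t. t \<in> {0..} \<and> ?d t \<noteq> ?d s \<longrightarrow> e \<le> norm (?d t - ?d s)"
      proof (intro exI[of _ "2 * pi"] conjI allI impI)
        fix t assume t: "t \<in> {0..} \<and> ?d t \<noteq> ?d s"
        obtain k l :: int where kl: "?d t = 2 * pi * of_int k" "?d s = 2 * pi * of_int l"
          using lattice[of t] lattice[of s] t \<open>s \<in> {0..}\<close> by auto
        have "k \<noteq> l" using t kl by auto
        then have "1 \<le> \<bar>k - l\<bar>" by linarith
        then have "1 \<le> \<bar>real_of_int (k - l)\<bar>" by linarith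
        then have "2 * pi * 1 \<le> 2 * pi * \<bar>real_of_int (k - l)\<bar>" by (intro mult_left_mono) auto
        also have "\<dots> = norm (?d t - ?d s)"
          unfolding kl right_diff_distrib[symmetric] by (simp add: abs_mult)
        finally show "2 * pi \<le> norm (?d t - ?d s)" by simp
      qed simp
    qed simp
    then show ?thesis using \<open>0 \<le> t\<close> unfolding constant_on_def by (metis atLeast_iff order_refl)
  qed
  then show ?thesis by (simp add: vec_eq_iff)
qed

text \<open>\<open>velocity\<close> is an arbitrary choice, so costs computed from a given lift
  agree with the \<open>lagrangian\<close> only up to a null set. Two lifts differ by a constant;
  hence their velocities have the same primitive.\<close>

lemma is_velocity_unique:
  assumes "is_velocity \<Phi> v" "is_velocity \<Phi> w"
  obtains N where "negligible N" "\<And>t. 0 \<le> t \<Longrightarrow> t \<notin> N \<Longrightarrow> v t = w t"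
proof -
  obtain \<phi> where \<phi>: "h1_lift \<phi> v" "\<forall>t\<ge>0. \<Phi> t = torus_of (\<phi> t)"
    using assms(1) is_velocity_iff_h1_lift by blast
  obtain \<psi> where \<psi>: "h1_lift \<psi> w" "\<forall>t\<ge>0. \<Phi> t = torus_of (\<psi> t)"
    using assms(2) is_velocity_iff_h1_lift by blast
  have int: "(\<lambda>t. v t - w t) integrable_on {0..T}" for T
  proof (cases "0 \<le> T")
    case True
    then show ?thesis by (intro integrable_diff h1_liftD(2)[OF \<phi>(1)] h1_liftD(2)[OF \<psi>(1)])
  qed (simp add: integrable_on_empty)
  have "integral {0..T} (\<lambda>t. v t - w t) = 0" if "0 \<le> T" for T
  proof -
    have "\<phi> T - \<psi> T = \<phi> 0 - \<psi> 0"
      by (rule torus_lift_difference_constant) (use h1_lift_continuous \<phi> \<psi> that in auto)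
    then have "integral {0..T} v = integral {0..T} w"
      using h1_liftD(4)[OF \<phi>(1) that] h1_liftD(4)[OF \<psi>(1) that] by (simp add: algebra_simps)
    then show ?thesis
      using h1_liftD(2)[OF \<phi>(1) that] h1_liftD(2)[OF \<psi>(1) that]
      by (simp add: Henstock_Kurzweil_Integration.integral_diff)
  qed
  from negligible_of_zero_primitive[OF int this] show thesis using that by (metis eq_iff_diff_eq_0)
qed

section \<open>Shifting and concatenating lifts in time\<close>

lemma h1_lift_shift:
  assumes "h1_lift \<phi> v" "0 \<le> s"
  shows "h1_lift (\<lambda>t. \<phi> (t + s)) (\<lambda>t. v (t + s))"
  unfolding h1_lift_def
proof (intro allI impI conjI)
  fix T :: real assume "0 \<le> T"
  have "v absolutely_integrable_on {s..T+s}"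
    by (rule absolutely_integrable_on_subinterval[OF h1_liftD(1)[OF assms(1), of "T+s"]])
       (use \<open>0 \<le> T\<close> \<open>0 \<le> s\<close> in auto)
  then show "(\<lambda>t. v (t + s)) absolutely_integrable_on {0..T}"
    using integrable_shift_real_ivl[of v s "T+s" s] integrable_shift_real_ivl[of "\<lambda>t. norm (v t)" s "T+s" s]
    by (simp add: absolutely_integrable_on_def)
  have "(\<lambda>t. (norm (v t))\<^sup>2) integrable_on {s..T+s}"
    by (rule integrable_subinterval_real[OF h1_liftD(3)[OF assms(1), of "T+s"]])
       (use \<open>0 \<le> T\<close> \<open>0 \<le> s\<close> in auto)
  then show "(\<lambda>t. (norm (v (t + s)))\<^sup>2) integrable_on {0..T}"
    using integrable_shift_real_ivl[of "\<lambda>t. (norm (v t))\<^sup>2" s "T+s" s] by simp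
  show "\<phi> (T + s) = \<phi> (0 + s) + integral {0..T} (\<lambda>t. v (t + s))"
    using h1_lift_increment[OF assms, of "T+s"] integral_shift_real_ivl[of s s "T+s" v] \<open>0 \<le> T\<close>
    by (simp add: algebra_simps)
qed

text \<open>At time \<open>s\<close> the value of \<open>g\<close> is taken. For lifts it equals
  that of \<open>h\<close> at 0; for velocities a single point does not affect the
  integrals.\<close>

definition concat_at :: "real \<Rightarrow> (real \<Rightarrow> 'a) \<Rightarrow> (real \<Rightarrow> 'a) \<Rightarrow> real \<Rightarrow> 'a" where
  "concat_at s g h t = (if t \<le> s then g t else h (t - s))"

lemma has_integral_concat_at:
  fixes g h :: "real \<Rightarrow> 'a::banach"
  assumes "0 \<le> s" "s \<le> T" "(g has_integral a) {0..s}" "(h has_integral b) {0..T - s}"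
  shows "(concat_at s g h has_integral a + b) {0..T}"
proof (rule has_integral_combine[OF assms(1,2)])
  show "(concat_at s g h has_integral a) {0..s}"
    by (rule has_integral_eq[OF _ assms(3)]) (simp add: concat_at_def)
  have "((\<lambda>t. h (t + - s)) has_integral b) {0 - - s..T - s - - s}"
    by (rule has_integral_shift_real_ivl[OF assms(4)])
  then have "((\<lambda>t. h (t - s)) has_integral b) {s..T}" by simp
  then show "(concat_at s g h has_integral b) {s..T}"
    by (rule has_integral_spike_finite[of "{s}", rotated 2]) (auto simp: concat_at_def)
qed

lemma has_integral_concat_at_left:
  fixes g h :: "real \<Rightarrow> 'a::banach"
  assumes "T \<le> s" "(g has_integral a) {0..T}"
  shows "(concat_at s g h has_integral a) {0..T}"
  by (rule has_integral_eq[OF _ assms(2)]) (use assms(1) in \<open>simp add: concat_at_def\<close>)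

lemma integrable_concat_at:
  fixes g h :: "real \<Rightarrow> 'a::banach"
  assumes "0 \<le> s" "0 \<le> T" "\<And>T. 0 \<le> T \<Longrightarrow> g integrable_on {0..T}" "\<And>T. 0 \<le> T \<Longrightarrow> h integrable_on {0..T}"
  shows "concat_at s g h integrable_on {0..T}"
proof (cases "s \<le> T")
  case True
  then show ?thesis
    using has_integral_concat_at[OF assms(1) True] assms(3)[OF assms(1)] assms(4)[of "T - s"]
    by (meson diff_ge_0_iff_ge integrable_on_def)
next
  case False
  then show ?thesis
    using has_integral_concat_at_left[of T s] assms(3)[OF assms(2)] by (meson integrable_on_def nle_le)
qed

lemma h1_lift_concat:
  assumes \<phi>: "h1_lift \<phi> v" and \<psi>: "h1_lift \<psi> w" and "0 \<le> s" "\<phi> s = \<psi> 0"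
  shows "h1_lift (concat_at s \<phi> \<psi>) (concat_at s v w)"
  unfolding h1_lift_def
proof (intro allI impI conjI)
  fix T :: real assume "0 \<le> T"
  have comp: "(\<lambda>t. F (concat_at s v w t)) = concat_at s (\<lambda>t. F (v t)) (\<lambda>t. F (w t))" for F :: "real ^ 'a \<Rightarrow> real"
    by (auto simp: concat_at_def)
  have n: "(\<lambda>t. norm (v t)) integrable_on {0..T}" "(\<lambda>t. norm (w t)) integrable_on {0..T}" if "0 \<le> T" for T
    using h1_liftD(1)[OF \<phi> that] h1_liftD(1)[OF \<psi> that] by (auto simp: absolutely_integrable_on_def)
  show "concat_at s v w absolutely_integrable_on {0..T}"
    unfolding absolutely_integrable_on_def comp[of norm]
    using \<open>0 \<le> s\<close> \<open>0 \<le> T\<close> n h1_liftD(2)[OF \<phi>] h1_liftD(2)[OF \<psi>] by (blast intro: integrable_concat_at)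
  show "(\<lambda>t. (norm (concat_at s v w t))\<^sup>2) integrable_on {0..T}"
    unfolding comp[of "\<lambda>x. (norm x)\<^sup>2"]
    using \<open>0 \<le> s\<close> \<open>0 \<le> T\<close> h1_liftD(3)[OF \<phi>] h1_liftD(3)[OF \<psi>] by (intro integrable_concat_at)
  show "concat_at s \<phi> \<psi> T = concat_at s \<phi> \<psi> 0 + integral {0..T} (concat_at s v w)"
  proof (cases "T \<le> s")
    case True
    then have "integral {0..T} (concat_at s v w) = integral {0..T} v"
      using h1_liftD(2)[OF \<phi> \<open>0 \<le> T\<close>] by (blast intro: integral_unique has_integral_concat_at_left)
    then show ?thesis using True \<open>0 \<le> s\<close> h1_liftD(4)[OF \<phi> \<open>0 \<le> T\<close>] by (simp add: concat_at_def)
  next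
    case False
    then have "integral {0..T} (concat_at s v w) = integral {0..s} v + integral {0..T - s} w"
      using h1_liftD(2)[OF \<phi> \<open>0 \<le> s\<close>] h1_liftD(2)[OF \<psi>, of "T - s"] \<open>0 \<le> s\<close>
      by (intro integral_unique has_integral_concat_at) auto
    then show ?thesis
      using False \<open>0 \<le> s\<close> h1_liftD(4)[OF \<phi> \<open>0 \<le> s\<close>] h1_liftD(4)[OF \<psi>, of "T - s"] \<open>\<phi> s = \<psi> 0\<close>
      by (simp add: concat_at_def)
  qed
qed


section \<open>Curves of finite cost\<close>

text \<open>Monotone convergence along the truncations to \<open>{0..k}\<close>. It recovers
  integrability on the half-line, as admissibility demands, from bounds on finite horizons.\<close>

lemma integral_halfline_le:
  fixes c :: "real \<Rightarrow> real"
  assumes nonneg: "\<And>t. 0 \<le> c t" and int: "\<And>T. 0 \<le> T \<Longrightarrow> c integrable_on {0..T}"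
    and B: "\<And>T. 0 \<le> T \<Longrightarrow> integral {0..T} c \<le> B"
  shows "c integrable_on {0..}" "integral {0..} c \<le> B"
proof -
  define f where "f k t = (if t \<in> {0..real k} then c t else 0)" for k t
  have f: "f k integrable_on {0..}" "integral {0..} (f k) = integral {0..real k} c" for k
  proof -
    have *: "{0..real k} \<inter> {0..} = {0..real k}" by auto
    show "f k integrable_on {0..}"
      unfolding f_def integrable_restrict_Int * by (rule int) simp
    show "integral {0..} (f k) = integral {0..real k} c"
      unfolding f_def integral_restrict_Int * ..
  qed
  have fc: "(\<lambda>k. f k t) \<longlonglongrightarrow> c t" if "t \<in> {0..}" for t
  proof (rule tendsto_eventually)
    obtain k0 :: nat where "t \<le> real k0" using real_arch_simple by blast
    then show "\<forall>\<^sub>F k in sequentially. f k t = c t"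
      by (intro eventually_mono[OF eventually_ge_at_top[of k0]]) (use that in \<open>auto simp: f_def\<close>)
  qed
  have "0 \<le> integral {0..} (f k) \<and> integral {0..} (f k) \<le> B" for k
    unfolding f by (intro conjI integral_nonneg int nonneg B) auto
  then have "bounded (range (\<lambda>k. integral {0..} (f k)))"
    by (intro boundedI[of _ B]) auto
  then have *: "c integrable_on {0..} \<and> (\<lambda>k. integral {0..} (f k)) \<longlonglongrightarrow> integral {0..} c"
    by (intro monotone_convergence_increasing f fc) (auto simp: f_def nonneg)
  then show "c integrable_on {0..}" by blast
  show "integral {0..} c \<le> B"
    by (rule LIMSEQ_le_const2[OF conjunct2[OF *]]) (auto simp: f intro!: B exI[of _ 0])
qed

definition path_cost :: "('n::finite torus \<Rightarrow> real) \<Rightarrow> (real \<Rightarrow> real ^ 'n) \<Rightarrow> (real \<Rightarrow> real ^ 'n) \<Rightarrow> real \<Rightarrow> real" where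
  "path_cost Q \<phi> v t = 1/2 * (norm (v t))\<^sup>2 + Q (torus_of (\<phi> t))"

text \<open>Bounding all finite-horizon costs by \<open>B\<close> replaces the infinite-horizon integral, so that
  concatenation of curves only involves compact intervals.\<close>
definition finite_cost_path :: "('n::finite torus \<Rightarrow> real) \<Rightarrow> (real \<Rightarrow> real ^ 'n) \<Rightarrow> (real \<Rightarrow> real ^ 'n) \<Rightarrow> real \<Rightarrow> bool" where
  "finite_cost_path Q \<phi> v B \<longleftrightarrow> h1_lift \<phi> v \<and> (\<forall>T\<ge>0. integral {0..T} (path_cost Q \<phi> v) \<le> B)"

text \<open>The setting for all arguments on curves. The Lipschitz bound is stated between arbitrary
  lifts, as it is applied along segments in R^n, and with the same constant that appears in the
  initial guess.\<close>

locale torus_potential =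
  fixes Q :: "'n::finite torus \<Rightarrow> real"
  assumes Q_nonneg: "0 \<le> Q \<theta>"
    and zero_set_nonempty: "zero_set Q \<noteq> {}"
    and Q_Lipschitz: "\<bar>Q (torus_of x) - Q (torus_of y)\<bar> \<le> max_gradient Q * norm (x - y)"
    and max_gradient_nonneg: "0 \<le> max_gradient Q"
begin

abbreviation "cost \<equiv> path_cost Q"
abbreviation "cpath \<equiv> finite_cost_path Q"

lemma cost_nonneg: "0 \<le> cost \<phi> v t"
  by (simp add: path_cost_def Q_nonneg)

lemma Q_torus_of_continuous: "continuous_on S (\<lambda>x. Q (torus_of x))"
  by (rule lipschitz_on_continuous_on[of "max_gradient Q"])
     (auto intro!: lipschitz_onI simp: dist_norm Q_Lipschitz max_gradient_nonneg)

lemma Q_path_continuous: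
  assumes "h1_lift \<phi> v"
  shows "continuous_on {0..} (\<lambda>t. Q (torus_of (\<phi> t)))"
  by (rule continuous_on_compose2[OF Q_torus_of_continuous h1_lift_continuous[OF assms]]) auto

lemma cost_integrable:
  assumes "h1_lift \<phi> v" "0 \<le> a"
  shows "cost \<phi> v integrable_on {a..b}"
proof (cases "0 \<le> b")
  case True
  have "continuous_on {0..b} (\<lambda>t. Q (torus_of (\<phi> t)))"
    by (rule continuous_on_subset[OF Q_path_continuous[OF assms(1)]]) auto
  then have "(\<lambda>t. 1/2 * (norm (v t))\<^sup>2 + Q (torus_of (\<phi> t))) integrable_on {0..b}"
    by (intro integrable_add integrable_on_mult_right h1_liftD(3)[OF assms(1) True] integrable_continuous_real)
  then have "cost \<phi> v integrable_on {0..b}" unfolding path_cost_def[abs_def] .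
  then show ?thesis by (rule integrable_subinterval_real) (use assms(2) in auto)
next
  case False
  then have "{a..b} = {}" using assms(2) by auto
  then show ?thesis by (simp add: integrable_on_empty)
qed

lemma cost_integral_combine:
  assumes "h1_lift \<phi> v" "0 \<le> a" "a \<le> b" "b \<le> c"
  shows "integral {a..b} (cost \<phi> v) + integral {b..c} (cost \<phi> v) = integral {a..c} (cost \<phi> v)"
  using assms by (intro Henstock_Kurzweil_Integration.integral_combine cost_integrable) auto

lemma cost_integral_nonneg:
  assumes "h1_lift \<phi> v" "0 \<le> a"
  shows "0 \<le> integral {a..b} (cost \<phi> v)"
  by (intro integral_nonneg cost_integrable assms cost_nonneg)

lemma path_mono: "cpath \<phi> v B \<Longrightarrow> B \<le> C \<Longrightarrow> cpath \<phi> v C"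
  unfolding finite_cost_path_def by (meson order_trans)

section \<open>Operations on curves of bounded cost\<close>

lemma path_shift:
  assumes "cpath \<phi> v B" "0 \<le> s"
  shows "cpath (\<lambda>t. \<phi> (t + s)) (\<lambda>t. v (t + s)) B"
    and "integral {0..T} (cost (\<lambda>t. \<phi> (t + s)) (\<lambda>t. v (t + s))) = integral {s..s + T} (cost \<phi> v)"
proof -
  have h: "h1_lift \<phi> v" and B: "\<And>T. 0 \<le> T \<Longrightarrow> integral {0..T} (cost \<phi> v) \<le> B"
    using assms(1) by (auto simp: finite_cost_path_def)
  have c: "cost (\<lambda>t. \<phi> (t + s)) (\<lambda>t. v (t + s)) = (\<lambda>t. cost \<phi> v (t + s))"
    by (simp add: path_cost_def fun_eq_iff)
  show eq: "integral {0..T} (cost (\<lambda>t. \<phi> (t + s)) (\<lambda>t. v (t + s))) = integral {s..s + T} (cost \<phi> v)" for T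
    unfolding c using integral_shift_real_ivl[of s s "s + T" "cost \<phi> v"] by simp
  have "integral {s..s + T} (cost \<phi> v) \<le> B" if "0 \<le> T" for T
    using cost_integral_combine[OF h order_refl assms(2), of "s + T"] B[of "s + T"]
      cost_integral_nonneg[OF h order_refl, of s] that assms(2) by simp
  then show "cpath (\<lambda>t. \<phi> (t + s)) (\<lambda>t. v (t + s)) B"
    unfolding finite_cost_path_def eq using h1_lift_shift[OF h assms(2)] by blast
qed

lemma cost_concat_at: "cost (concat_at s \<phi> \<psi>) (concat_at s v w) = concat_at s (cost \<phi> v) (cost \<psi> w)"
  by (auto simp: path_cost_def concat_at_def fun_eq_iff)

text \<open>The cost before \<open>s\<close> is kept exactly, the cost afterwards only through its
  bound \<open>B\<close>. This asymmetry is what dynamic programming uses; horizons shorter than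
  \<open>s\<close> are covered since costs and \<open>B\<close> are nonnegative.\<close>

lemma path_concat:
  assumes \<phi>: "h1_lift \<phi> v" and \<psi>: "cpath \<psi> w B" and "0 \<le> s" "\<phi> s = \<psi> 0"
  shows "cpath (concat_at s \<phi> \<psi>) (concat_at s v w) (integral {0..s} (cost \<phi> v) + B)"
proof -
  have h: "h1_lift \<psi> w" and B: "\<And>T. 0 \<le> T \<Longrightarrow> integral {0..T} (cost \<psi> w) \<le> B"
    using \<psi> by (auto simp: finite_cost_path_def)
  have "integral {0..T} (cost (concat_at s \<phi> \<psi>) (concat_at s v w)) \<le> integral {0..s} (cost \<phi> v) + B" if "0 \<le> T" for T
  proof (cases "T \<le> s")
    case True
    have "integral {0..T} (concat_at s (cost \<phi> v) (cost \<psi> w)) = integral {0..T} (cost \<phi> v)"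
      by (intro integral_unique has_integral_concat_at_left[OF True] integrable_integral cost_integrable \<phi>) simp
    moreover have "integral {0..T} (cost \<phi> v) \<le> integral {0..s} (cost \<phi> v)"
      using cost_integral_combine[OF \<phi> order_refl that True] cost_integral_nonneg[OF \<phi> that, of s] by simp
    moreover have "0 \<le> B" using B[of 0] by simp
    ultimately show ?thesis unfolding cost_concat_at by simp
  next
    case False
    then have "integral {0..T} (concat_at s (cost \<phi> v) (cost \<psi> w))
        = integral {0..s} (cost \<phi> v) + integral {0..T - s} (cost \<psi> w)"
      using \<open>0 \<le> s\<close> by (intro integral_unique has_integral_concat_at integrable_integral cost_integrable \<phi> h) auto
    then show ?thesis unfolding cost_concat_at using B[of "T - s"] False by simp
  qed
  then show ?thesis
    unfolding finite_cost_path_def using h1_lift_concat[OF \<phi> h \<open>0 \<le> s\<close> \<open>\<phi> s = \<psi> 0\<close>] by blast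
qed

text \<open>Origin of the initial guess. Constant speed over unit time costs half the squared length
  in kinetic energy. At time t the remaining distance is (1 - t) times the length, so the potential
  is at most \<open>max_gradient Q\<close> times this, and the factor 1 - t integrates to 1/2.
  Resting at the zero afterwards is free.\<close>

lemma segment_path:
  assumes z: "Q (torus_of z) = 0"
  shows "\<exists>\<phi> v. \<phi> 0 = x \<and> cpath \<phi> v (1/2 * (norm (z - x))\<^sup>2 + max_gradient Q / 2 * norm (z - x))"
proof -
  let ?n = "norm (z - x)" and ?L = "max_gradient Q"
  define \<phi> where "\<phi> t = x + t *\<^sub>R (z - x)" for t
  have \<phi>: "h1_lift \<phi> (\<lambda>_. z - x)"
    unfolding h1_lift_def by (auto simp: \<phi>_def integrable_const_ivl)
  have \<psi>: "cpath (\<lambda>_. z) (\<lambda>_. 0) 0"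
    unfolding finite_cost_path_def h1_lift_def by (auto simp: path_cost_def[abs_def] z)
  have "integral {0..1} (cost \<phi> (\<lambda>_. z - x)) \<le> integral {0..1} (\<lambda>t. 1/2 * ?n\<^sup>2 + ?L * ?n * (1 - t))"
  proof (rule integral_le)
    show "cost \<phi> (\<lambda>_. z - x) integrable_on {0..1}" by (rule cost_integrable[OF \<phi>]) simp
    show "(\<lambda>t. 1/2 * ?n\<^sup>2 + ?L * ?n * (1 - t)) integrable_on {0..1::real}"
      by (intro integrable_continuous_real continuous_intros)
    fix t :: real assume t: "t \<in> {0..1}"
    have "\<phi> t - z = (1 - t) *\<^sub>R (x - z)" by (simp add: \<phi>_def algebra_simps)
    then have "norm (\<phi> t - z) = (1 - t) * ?n" using t by (simp add: norm_minus_commute)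
    then have "Q (torus_of (\<phi> t)) \<le> ?L * ((1 - t) * ?n)" using Q_Lipschitz[of "\<phi> t" z] z by simp
    then show "cost \<phi> (\<lambda>_. z - x) t \<le> 1/2 * ?n\<^sup>2 + ?L * ?n * (1 - t)"
      by (simp add: path_cost_def mult_ac)
  qed
  also have "\<dots> = 1/2 * ?n\<^sup>2 + ?L / 2 * ?n"
  proof (rule integral_unique)
    have "((\<lambda>t. 1/2 * ?n\<^sup>2 + ?L * ?n * (1 - t)) has_integral
        (1/2 * ?n\<^sup>2 * 1 + ?L * ?n * (1 - 1\<^sup>2 / 2)) - (1/2 * ?n\<^sup>2 * 0 + ?L * ?n * (0 - 0\<^sup>2 / 2))) {0..1::real}"
      by (rule fundamental_theorem_of_calculus)
         (auto intro!: derivative_eq_intros simp: has_real_derivative_iff_has_vector_derivative[symmetric])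
    then show "((\<lambda>t. 1/2 * ?n\<^sup>2 + ?L * ?n * (1 - t)) has_integral 1/2 * ?n\<^sup>2 + ?L / 2 * ?n) {0..1::real}"
      by simp
  qed
  finally have le: "integral {0..1} (cost \<phi> (\<lambda>_. z - x)) + 0 \<le> 1/2 * ?n\<^sup>2 + ?L / 2 * ?n" by simp
  have "cpath (concat_at 1 \<phi> (\<lambda>_. z)) (concat_at 1 (\<lambda>_. z - x) (\<lambda>_. 0)) (1/2 * ?n\<^sup>2 + ?L / 2 * ?n)"
    by (rule path_mono[OF path_concat[OF \<phi> \<psi>] le]) (auto simp: \<phi>_def)
  moreover have "concat_at 1 \<phi> (\<lambda>_. z) 0 = x" by (simp add: concat_at_def \<phi>_def)
  ultimately show ?thesis by blast
qed

lemma lagrangian_nonneg: "0 \<le> lagrangian Q \<Phi> t"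
  by (simp add: lagrangian_def Q_nonneg)

section \<open>Admissible curves on the torus versus lifts of bounded cost\<close>

text \<open>The lift may start at any prescribed representative \<open>x\<close>, since lifts can be
  translated by lattice vectors; later gluing requires matching lifts, not just matching torus
  points. With \<open>v\<close> taken to be \<open>velocity \<Phi>\<close>, Lagrangian and cost
  agree at all times t >= 0.\<close>

lemma admissible_imp_path:
  assumes "\<Phi> \<in> admissible Q (torus_of x)"
  obtains \<phi> v where "\<phi> 0 = x" "cpath \<phi> v (LINT t:{0<..}|lebesgue. lagrangian Q \<Phi> t)"
    "\<And>t. 0 \<le> t \<Longrightarrow> \<Phi> t = torus_of (\<phi> t)"
    "\<And>s. (LINT t:{0<..<s}|lebesgue. lagrangian Q \<Phi> t) = integral {0..s} (cost \<phi> v)"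
proof -
  define v where "v = velocity \<Phi>"
  have ex: "\<exists>v. is_velocity \<Phi> v" and \<Phi>0: "\<Phi> 0 = torus_of x"
    and si: "set_integrable lebesgue {0<..} (lagrangian Q \<Phi>)"
    using assms by (auto simp: admissible_def H1_loc_def)
  have "is_velocity \<Phi> v" unfolding v_def velocity_def by (rule someI_ex[OF ex])
  then obtain \<phi>0 where \<phi>0: "h1_lift \<phi>0 v" "\<forall>t\<ge>0. \<Phi> t = torus_of (\<phi>0 t)"
    unfolding is_velocity_iff_h1_lift by blast
  define \<phi> where "\<phi> t = \<phi>0 t + (x - \<phi>0 0)" for t
  have h: "h1_lift \<phi> v" unfolding \<phi>_def[abs_def] by (rule h1_lift_translate[OF \<phi>0(1)])
  have eq: "\<Phi> t = torus_of (\<phi> t)" if "0 \<le> t" for t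
  proof -
    have "torus_of x = torus_of (\<phi>0 0)" using \<phi>0(2)[rule_format, OF order_refl] \<Phi>0 by metis
    from torus_of_add_cong[OF this, of "\<phi>0 t - \<phi>0 0"]
    have "torus_of (\<phi> t) = torus_of (\<phi>0 t)" by (simp add: \<phi>_def algebra_simps)
    then show ?thesis using \<phi>0(2) that by metis
  qed
  have lc: "lagrangian Q \<Phi> t = cost \<phi> v t" if "0 \<le> t" for t
    using eq[OF that] by (simp add: lagrangian_def path_cost_def v_def)
  have i: "cost \<phi> v integrable_on {0<..}"
    by (rule integrable_eq[OF set_lebesgue_integral_eq_integral(1)[OF si]]) (simp add: lc)
  have neg: "negligible {t \<in> {0<..} - {0..}. cost \<phi> v t \<noteq> 0}" "negligible {t \<in> {0..} - {0<..}. cost \<phi> v t \<noteq> 0}"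
    by (rule negligible_subset[of "{0}"]; auto)+
  have i0: "cost \<phi> v integrable_on {0..}" by (rule integrable_spike_set[OF i neg])
  have "(LINT t:{0<..}|lebesgue. lagrangian Q \<Phi> t) = integral {0<..} (lagrangian Q \<Phi>)"
    by (rule set_lebesgue_integral_eq_integral(2)[OF si])
  also have "\<dots> = integral {0<..} (cost \<phi> v)"
    by (rule Henstock_Kurzweil_Integration.integral_cong) (simp add: lc)
  also have "\<dots> = integral {0..} (cost \<phi> v)"
    by (rule integral_spike_set[OF neg])
  finally have J: "(LINT t:{0<..}|lebesgue. lagrangian Q \<Phi> t) = integral {0..} (cost \<phi> v)" .
  show thesis
  proof (rule that)
    show "\<phi> 0 = x" by (simp add: \<phi>_def)
    show "cpath \<phi> v (LINT t:{0<..}|lebesgue. lagrangian Q \<Phi> t)"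
      unfolding finite_cost_path_def J
      by (intro conjI h allI impI integral_subset_le cost_integrable[OF h] i0) (auto simp: cost_nonneg)
    show "\<Phi> t = torus_of (\<phi> t)" if "0 \<le> t" for t by (rule eq[OF that])
    show "(LINT t:{0<..<s}|lebesgue. lagrangian Q \<Phi> t) = integral {0..s} (cost \<phi> v)" for s
    proof -
      have "lagrangian Q \<Phi> integrable_on {0..s}"
        by (rule integrable_eq[OF cost_integrable[OF h order_refl]]) (simp add: lc)
      then have "lagrangian Q \<Phi> absolutely_integrable_on {0..s}"
        by (rule nonnegative_absolutely_integrable_1) (rule lagrangian_nonneg)
      then have "(LINT t:{0<..<s}|lebesgue. lagrangian Q \<Phi> t) = integral {0..s} (lagrangian Q \<Phi>)"
        by (rule LINT_Ioo_eq_integral)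
      also have "\<dots> = integral {0..s} (cost \<phi> v)"
        by (rule Henstock_Kurzweil_Integration.integral_cong) (simp add: lc)
      finally show ?thesis .
    qed
  qed
qed

text \<open>Here the chosen \<open>velocity\<close> may differ from the given \<open>v\<close>, so
  Lagrangian and cost are identified off a null set of times by uniqueness of the velocity.\<close>

lemma path_imp_admissible:
  assumes "cpath \<phi> v B"
  defines "\<Phi> \<equiv> \<lambda>t. torus_of (\<phi> t)"
  shows "\<Phi> \<in> admissible Q (torus_of (\<phi> 0))"
    "(LINT t:{0<..}|lebesgue. lagrangian Q \<Phi> t) \<le> B"
    "(LINT t:{0<..<s}|lebesgue. lagrangian Q \<Phi> t) = integral {0..s} (cost \<phi> v)"
proof -
  have h: "h1_lift \<phi> v" and B: "\<And>T. 0 \<le> T \<Longrightarrow> integral {0..T} (cost \<phi> v) \<le> B"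
    using assms(1) by (auto simp: finite_cost_path_def)
  have vel: "is_velocity \<Phi> v" unfolding is_velocity_iff_h1_lift \<Phi>_def using h by blast
  then have "\<exists>v. is_velocity \<Phi> v" by blast
  then have "is_velocity \<Phi> (velocity \<Phi>)" unfolding velocity_def by (rule someI_ex)
  from is_velocity_unique[OF this vel] obtain N
    where N: "negligible N" "\<And>t. 0 \<le> t \<Longrightarrow> t \<notin> N \<Longrightarrow> velocity \<Phi> t = v t" by blast
  have lc: "lagrangian Q \<Phi> t = cost \<phi> v t" if "0 \<le> t" "t \<notin> N" for t
    using N(2)[OF that] by (simp add: lagrangian_def path_cost_def \<Phi>_def)
  note half = integral_halfline_le[of "cost \<phi> v", OF cost_nonneg cost_integrable[OF h order_refl] B]
  have neg: "negligible {t \<in> {0<..} - {0..}. cost \<phi> v t \<noteq> 0}" "negligible {t \<in> {0..} - {0<..}. cost \<phi> v t \<noteq> 0}"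
    by (rule negligible_subset[of "{0}"]; auto)+
  have i: "cost \<phi> v integrable_on {0<..}"
    by (rule integrable_spike_set[OF half(1) neg(2,1)])
  have "lagrangian Q \<Phi> integrable_on {0<..}"
    by (rule integrable_spike[OF i N(1)]) (simp add: lc)
  then have ai: "lagrangian Q \<Phi> absolutely_integrable_on {0<..}"
    by (rule nonnegative_absolutely_integrable_1) (rule lagrangian_nonneg)
  then show "\<Phi> \<in> admissible Q (torus_of (\<phi> 0))"
    using vel by (auto simp: admissible_def H1_loc_def \<Phi>_def)
  have "(LINT t:{0<..}|lebesgue. lagrangian Q \<Phi> t) = integral {0<..} (lagrangian Q \<Phi>)"
    by (rule set_lebesgue_integral_eq_integral(2)[OF ai])
  also have "\<dots> = integral {0<..} (cost \<phi> v)"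
    by (rule integral_spike[OF N(1)]) (simp add: lc)
  also have "\<dots> = integral {0..} (cost \<phi> v)" by (rule integral_spike_set[OF neg])
  finally show "(LINT t:{0<..}|lebesgue. lagrangian Q \<Phi> t) \<le> B" using half(2) by simp
  have "lagrangian Q \<Phi> integrable_on {0..s}"
    by (rule integrable_spike[OF cost_integrable[OF h order_refl] N(1)]) (simp add: lc)
  then have "lagrangian Q \<Phi> absolutely_integrable_on {0..s}"
    by (rule nonnegative_absolutely_integrable_1) (rule lagrangian_nonneg)
  then have "(LINT t:{0<..<s}|lebesgue. lagrangian Q \<Phi> t) = integral {0..s} (lagrangian Q \<Phi>)"
    by (rule LINT_Ioo_eq_integral)
  also have "\<dots> = integral {0..s} (cost \<phi> v)"
    by (rule integral_spike[OF N(1)]) (simp add: lc)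
  finally show "(LINT t:{0<..<s}|lebesgue. lagrangian Q \<Phi> t) = integral {0..s} (cost \<phi> v)" .
qed

section \<open>The infima expressed through lifts\<close>

lemma LINT_lagrangian_nonneg: "0 \<le> (LINT t:S|lebesgue. lagrangian Q \<Phi> t)"
  unfolding set_lebesgue_integral_def by (intro integral_nonneg_AE) (simp add: lagrangian_nonneg)

text \<open>Ensures that the infima are taken over nonempty sets, so that near-optimal curves can be
  extracted from them.\<close>

lemma admissible_nonempty: "admissible Q p \<noteq> {}"
proof -
  obtain q where "q \<in> zero_set Q" using zero_set_nonempty by blast
  moreover obtain z where "torus_of z = q" using torus_of_surj by blast
  ultimately have z: "Q (torus_of z) = 0" by (auto simp: zero_set_def)
  obtain x where "torus_of x = p" using torus_of_surj by blast
  then show ?thesis using segment_path[OF z, of x] path_imp_admissible(1) by blast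
qed

lemma value_function_le:
  assumes "cpath \<phi> v B"
  shows "value_function Q (torus_of (\<phi> 0)) \<le> B"
proof -
  have "value_function Q (torus_of (\<phi> 0)) \<le> (LINT t:{0<..}|lebesgue. lagrangian Q (\<lambda>t. torus_of (\<phi> t)) t)"
    unfolding value_function_def
    by (rule cINF_lower[OF _ path_imp_admissible(1)[OF assms]])
       (auto intro!: bdd_belowI[of _ 0] LINT_lagrangian_nonneg)
  then show ?thesis using path_imp_admissible(2)[OF assms] by simp
qed

lemma value_function_approx:
  assumes "value_function Q (torus_of x) < C"
  obtains \<phi> v where "\<phi> 0 = x" "cpath \<phi> v C"
proof -
  obtain \<Phi> where \<Phi>: "\<Phi> \<in> admissible Q (torus_of x)" "(LINT t:{0<..}|lebesgue. lagrangian Q \<Phi> t) < C"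
    using assms cInf_lessD[of "(\<lambda>\<Phi>. LINT t:{0<..}|lebesgue. lagrangian Q \<Phi> t) ` admissible Q (torus_of x)" C]
      admissible_nonempty[of "torus_of x"]
    unfolding value_function_def by auto
  from admissible_imp_path[OF \<Phi>(1)] obtain \<phi> v
    where "\<phi> 0 = x" "cpath \<phi> v (LINT t:{0<..}|lebesgue. lagrangian Q \<Phi> t)" by metis
  then show thesis using path_mono[OF _ less_imp_le[OF \<Phi>(2)]] that by blast
qed

lemma value_iteration_nonneg: "0 \<le> value_iteration Q \<delta> i \<theta>"
proof (induction i arbitrary: \<theta>)
  case 0
  show ?case using infdist_nonneg[of \<theta> "zero_set Q"] max_gradient_nonneg by simp
next
  case (Suc i)
  show ?case
    unfolding value_iteration.simps
    by (rule cINF_greatest[OF admissible_nonempty]) (intro add_nonneg_nonneg LINT_lagrangian_nonneg Suc)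
qed

lemma value_iteration_Suc_le:
  assumes "cpath \<phi> v B" "0 < \<delta>"
  shows "value_iteration Q \<delta> (Suc i) (torus_of (\<phi> 0))
    \<le> integral {0..\<delta>} (cost \<phi> v) + value_iteration Q \<delta> i (torus_of (\<phi> \<delta>))"
proof -
  have "value_iteration Q \<delta> (Suc i) (torus_of (\<phi> 0))
    \<le> (LINT s:{0<..<\<delta>}|lebesgue. lagrangian Q (\<lambda>t. torus_of (\<phi> t)) s) + value_iteration Q \<delta> i (torus_of (\<phi> \<delta>))"
    unfolding value_iteration.simps
    by (rule cINF_lower[OF _ path_imp_admissible(1)[OF assms(1)]])
       (auto intro!: bdd_belowI[of _ 0] add_nonneg_nonneg LINT_lagrangian_nonneg value_iteration_nonneg)
  then show ?thesis by (simp only: path_imp_admissible(3)[OF assms(1)])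
qed

text \<open>\<open>B\<close> merely records that the total cost is finite; the comparison with
  \<open>C\<close> concerns the time up to \<open>\<delta>\<close>.\<close>

lemma value_iteration_Suc_approx:
  assumes "value_iteration Q \<delta> (Suc i) (torus_of x) < C" "0 < \<delta>"
  obtains \<phi> v B where "\<phi> 0 = x" "cpath \<phi> v B"
    "integral {0..\<delta>} (cost \<phi> v) + value_iteration Q \<delta> i (torus_of (\<phi> \<delta>)) < C"
proof -
  obtain \<Phi> where \<Phi>: "\<Phi> \<in> admissible Q (torus_of x)"
    "(LINT s:{0<..<\<delta>}|lebesgue. lagrangian Q \<Phi> s) + value_iteration Q \<delta> i (\<Phi> \<delta>) < C"
    using assms cInf_lessD[of "(\<lambda>\<Phi>. (LINT s:{0<..<\<delta>}|lebesgue. lagrangian Q \<Phi> s) + value_iteration Q \<delta> i (\<Phi> \<delta>)) ` admissible Q (torus_of x)" C]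
      admissible_nonempty[of "torus_of x"]
    by auto
  from admissible_imp_path[OF \<Phi>(1)] obtain \<phi> v
    where "\<phi> 0 = x" "cpath \<phi> v (LINT t:{0<..}|lebesgue. lagrangian Q \<Phi> t)" "\<Phi> \<delta> = torus_of (\<phi> \<delta>)"
      "(LINT t:{0<..<\<delta>}|lebesgue. lagrangian Q \<Phi> t) = integral {0..\<delta>} (cost \<phi> v)"
    using assms(2) by (metis less_imp_le)
  then show thesis using \<Phi>(2) that by metis
qed


section \<open>Convergence of value iteration\<close>

lemma infdist_zero_set_le: "infdist p (zero_set Q) \<le> 2 * pi * sqrt (real CARD('n))"
proof -
  obtain q where "q \<in> zero_set Q" using zero_set_nonempty by blast
  then have "infdist p (zero_set Q) \<le> dist p q" by (rule infdist_le)
  then show ?thesis using dist_torus_le_diameter[of p q] by linarith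
qed

lemma value_iteration_0_mono:
  assumes "infdist p (zero_set Q) \<le> \<rho>"
  shows "value_iteration Q \<delta> 0 p \<le> 1/2 * \<rho>\<^sup>2 + max_gradient Q / 2 * \<rho>"
  using assms infdist_nonneg[of p "zero_set Q"] max_gradient_nonneg
  by (simp add: add_mono power_mono mult_left_mono)

text \<open>In place of a nearest zero, zeros closer than \<open>\<rho>\<close> are used for every
  \<open>\<rho>\<close> above the distance, and \<open>\<rho>\<close> then decreases to it. Lifting
  the zero closest to \<open>x\<close> turns torus distance into segment length.\<close>

lemma value_function_le_value_iteration_0: "value_function Q p \<le> value_iteration Q \<delta> 0 p"
proof -
  let ?\<rho> = "infdist p (zero_set Q)" and ?h = "\<lambda>\<rho>. 1/2 * \<rho>\<^sup>2 + max_gradient Q / 2 * \<rho>"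
  have le: "value_function Q p \<le> ?h \<rho>" if "?\<rho> < \<rho>" for \<rho>
  proof -
    have "\<exists>q\<in>zero_set Q. dist p q < \<rho>"
      using that cInf_lessD[of "dist p ` zero_set Q" \<rho>] zero_set_nonempty by (auto simp: infdist_def)
    then obtain q where q: "q \<in> zero_set Q" "dist p q < \<rho>" by blast
    obtain x where x: "torus_of x = p" using torus_of_surj by blast
    obtain z where z: "torus_of z = q" "dist q p = dist z x"
      using dist_torus_attained[of q x] x by metis
    have "Q (torus_of z) = 0" using q(1) z(1) by (simp add: zero_set_def)
    from segment_path[OF this, of x] obtain \<phi> v
      where \<phi>: "\<phi> 0 = x" "cpath \<phi> v (?h (norm (z - x)))" by blast
    have "value_function Q p \<le> ?h (norm (z - x))" using value_function_le[OF \<phi>(2)] \<phi>(1) x by simp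
    also have "\<dots> \<le> ?h \<rho>"
      using q(2) z(2) max_gradient_nonneg
      by (intro add_mono mult_left_mono power_mono) (auto simp: dist_norm dist_commute[of p q])
    finally show ?thesis .
  qed
  have "value_function Q p \<le> ?h ?\<rho>"
  proof (rule tendsto_lowerbound)
    show "(?h \<longlongrightarrow> ?h ?\<rho>) (at_right ?\<rho>)" by (intro tendsto_intros)
    show "\<forall>\<^sub>F \<rho> in at_right ?\<rho>. value_function Q p \<le> ?h \<rho>"
      using eventually_at_right_less[of ?\<rho>] by eventually_elim (rule le)
  qed simp
  then show ?thesis by simp
qed

lemma value_function_le_value_iteration:
  assumes "0 < \<delta>"
  shows "value_function Q p \<le> value_iteration Q \<delta> i p"
proof (induction i arbitrary: p)
  case 0
  show ?case by (rule value_function_le_value_iteration_0)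
next
  case (Suc i)
  obtain x where x: "torus_of x = p" using torus_of_surj by blast
  show ?case
  proof (rule dense_ge)
    fix C assume "value_iteration Q \<delta> (Suc i) p < C"
    then have "value_iteration Q \<delta> (Suc i) (torus_of x) < C" by (simp only: x)
    then obtain \<phi> v B where \<phi>: "\<phi> 0 = x" "cpath \<phi> v B"
      "integral {0..\<delta>} (cost \<phi> v) + value_iteration Q \<delta> i (torus_of (\<phi> \<delta>)) < C"
      using assms by (rule value_iteration_Suc_approx)
    \<comment> \<open>The strict slack below \<open>C\<close> leaves room for a continuation whose
      cost is at most what the first step leaves of \<open>C\<close>; glued together, the two curves
      cost at most \<open>C\<close>.\<close>
    then have "value_function Q (torus_of (\<phi> \<delta>)) < C - integral {0..\<delta>} (cost \<phi> v)"
      using Suc[of "torus_of (\<phi> \<delta>)"] by simp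
    then obtain \<psi> w where \<psi>: "\<psi> 0 = \<phi> \<delta>" "cpath \<psi> w (C - integral {0..\<delta>} (cost \<phi> v))"
      by (rule value_function_approx)
    have "h1_lift \<phi> v" using \<phi>(2) by (simp add: finite_cost_path_def)
    from value_function_le[OF path_concat[OF this \<psi>(2)], of \<delta>] \<psi>(1) assms \<phi>(1) x
    show "value_function Q p \<le> C" by (simp add: concat_at_def)
  qed
qed

text \<open>Each minimization is bounded by the same curve, cut into pieces of length
  \<open>\<delta>\<close>. The induction varies the curve, because the remaining steps see its time
  shift.\<close>

lemma value_iteration_le_path:
  assumes "cpath \<phi> v B" "0 < \<delta>"
  shows "value_iteration Q \<delta> i (torus_of (\<phi> 0))
    \<le> integral {0..real i * \<delta>} (cost \<phi> v) + value_iteration Q \<delta> 0 (torus_of (\<phi> (real i * \<delta>)))"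
  using assms(1)
proof (induction i arbitrary: \<phi> v)
  case 0
  show ?case by simp
next
  case (Suc i)
  have h: "h1_lift \<phi> v" using Suc.prems by (simp add: finite_cost_path_def)
  have d: "0 \<le> \<delta>" using assms(2) by simp
  have "value_iteration Q \<delta> i (torus_of (\<phi> (0 + \<delta>))) \<le> integral {\<delta>..\<delta> + real i * \<delta>} (cost \<phi> v)
      + value_iteration Q \<delta> 0 (torus_of (\<phi> (real i * \<delta> + \<delta>)))"
    using Suc.IH[OF path_shift(1)[OF Suc.prems d]] unfolding path_shift(2)[OF Suc.prems d] .
  moreover have "integral {0..\<delta>} (cost \<phi> v) + integral {\<delta>..\<delta> + real i * \<delta>} (cost \<phi> v)
      = integral {0..\<delta> + real i * \<delta>} (cost \<phi> v)"
    by (rule cost_integral_combine[OF h]) (use d in auto)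
  moreover have "value_iteration Q \<delta> (Suc i) (torus_of (\<phi> 0))
    \<le> integral {0..\<delta>} (cost \<phi> v) + value_iteration Q \<delta> i (torus_of (\<phi> \<delta>))"
    by (rule value_iteration_Suc_le[OF Suc.prems assms(2)])
  moreover have "real (Suc i) * \<delta> = \<delta> + real i * \<delta>" "real i * \<delta> + \<delta> = \<delta> + real i * \<delta>"
    by (simp_all add: algebra_simps)
  ultimately show ?case by (simp del: value_iteration.simps)
qed

text \<open>Within one unit of time the curve either travels half of its distance to the zero set, or it
  stays where the potential is bounded below.\<close>
lemma cost_lower_bound:
  fixes T :: real
  assumes h: "h1_lift \<phi> v" and "0 \<le> T" "0 < d" "0 < N"
    and Loj: "\<And>\<theta>. d * infdist \<theta> (zero_set Q) powr N \<le> Q \<theta>"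
  defines "r \<equiv> infdist (torus_of (\<phi> T)) (zero_set Q)"
  shows "min (r\<^sup>2 / 8) (d * (r / 2) powr N) \<le> integral {T..T + 1} (cost \<phi> v)"
proof (cases "\<exists>t\<in>{T..T + 1}. r / 2 \<le> norm (\<phi> t - \<phi> T)")
  case True
  then obtain t where t: "T \<le> t" "t \<le> T + 1" "r / 2 \<le> norm (\<phi> t - \<phi> T)" by auto
  have r: "0 \<le> r" by (simp add: r_def infdist_nonneg)
  have "v absolutely_integrable_on {T..t}"
    by (rule absolutely_integrable_on_subinterval[OF h1_liftD(1)[OF h, of t]]) (use t \<open>0 \<le> T\<close> in auto)
  then have int: "v integrable_on {T..t}" "(\<lambda>s. norm (v s)) integrable_on {T..t}"
    by (auto simp: absolutely_integrable_on_def)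
  have "r / 2 \<le> norm (integral {T..t} v)" using t h1_lift_increment[OF h \<open>0 \<le> T\<close> t(1)] by simp
  also have "\<dots> \<le> integral {T..t} (\<lambda>s. norm (v s))"
    by (rule integral_norm_bound_integral[OF int]) simp
  finally have A: "r / 2 \<le> integral {T..t} (\<lambda>s. norm (v s))" .
  \<comment> \<open>Squaring \<open>norm (v s) - r / 2\<close> bounds the kinetic energy below by
    \<open>r / 2 * norm (v s) - r\<^sup>2 / 8\<close>. A path length of at least r/2 in time at most
    1 then costs at least r^2/4 - r^2/8.\<close>
  have "r\<^sup>2 / 8 \<le> r / 2 * (r / 2) - r\<^sup>2 / 8 * (t - T)"
    using t mult_left_mono[of "t - T" 1 "r\<^sup>2 / 8"] by (simp add: power2_eq_square)
  also have "\<dots> \<le> r / 2 * integral {T..t} (\<lambda>s. norm (v s)) - r\<^sup>2 / 8 * (t - T)"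
    using mult_left_mono[OF A, of "r / 2"] r by simp
  also have "\<dots> = integral {T..t} (\<lambda>s. r / 2 * norm (v s) - r\<^sup>2 / 8)"
    using int(2) t by (subst Henstock_Kurzweil_Integration.integral_diff) (auto intro: integrable_on_mult_right)
  also have "\<dots> \<le> integral {T..t} (cost \<phi> v)"
  proof (rule integral_le)
    show "(\<lambda>s. r / 2 * norm (v s) - r\<^sup>2 / 8) integrable_on {T..t}"
      using int(2) by (intro integrable_diff integrable_on_mult_right) auto
    show "cost \<phi> v integrable_on {T..t}" by (rule cost_integrable[OF h \<open>0 \<le> T\<close>])
    fix s
    have "0 \<le> (norm (v s) - r / 2)\<^sup>2" by simp
    then have "r / 2 * norm (v s) - r\<^sup>2 / 8 \<le> 1/2 * (norm (v s))\<^sup>2"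
      by (simp add: power2_eq_square algebra_simps)
    then show "r / 2 * norm (v s) - r\<^sup>2 / 8 \<le> cost \<phi> v s"
      using Q_nonneg[of "torus_of (\<phi> s)"] by (simp add: path_cost_def)
  qed
  also have "\<dots> \<le> integral {T..T + 1} (cost \<phi> v)"
    using cost_integral_combine[OF h \<open>0 \<le> T\<close> t(1,2)] cost_integral_nonneg[OF h, of t "T + 1"] t \<open>0 \<le> T\<close> by simp
  finally show ?thesis by simp
next
  case False
  have "integral {T..T + 1} (\<lambda>_. d * (r / 2) powr N) \<le> integral {T..T + 1} (cost \<phi> v)"
  proof (rule integral_le)
    show "(\<lambda>_. d * (r / 2) powr N) integrable_on {T..T + 1}" by (rule integrable_const_ivl)
    show "cost \<phi> v integrable_on {T..T + 1}" by (rule cost_integrable[OF h \<open>0 \<le> T\<close>])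
    fix t assume "t \<in> {T..T + 1}"
    then have "norm (\<phi> t - \<phi> T) < r / 2" using False by (meson not_le)
    then have "dist (torus_of (\<phi> T)) (torus_of (\<phi> t)) < r / 2"
      using dist_torus_of_le[of "\<phi> T" "\<phi> t"] by (simp add: dist_norm norm_minus_commute)
    then have "r / 2 \<le> infdist (torus_of (\<phi> t)) (zero_set Q)"
      using infdist_triangle[of "torus_of (\<phi> T)" "zero_set Q" "torus_of (\<phi> t)"] by (simp add: r_def)
    then have "(r / 2) powr N \<le> infdist (torus_of (\<phi> t)) (zero_set Q) powr N"
      using \<open>0 < N\<close> by (intro powr_mono2) (auto simp: r_def infdist_nonneg)
    then have "d * (r / 2) powr N \<le> d * infdist (torus_of (\<phi> t)) (zero_set Q) powr N"
      using \<open>0 < d\<close> by simp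
    also have "\<dots> \<le> Q (torus_of (\<phi> t))" by (rule Loj)
    also have "\<dots> \<le> cost \<phi> v t" by (simp add: path_cost_def)
    finally show "d * (r / 2) powr N \<le> cost \<phi> v t" .
  qed
  then show ?thesis by simp
qed

end

section \<open>Comparison of powers and the quantitative estimate\<close>

text \<open>Explains the maximum in \<open>\<sigma>1\<close>: one entry serves each case of the
  minimum. As \<open>N'\<close> is at least both 2 and \<open>N\<close>, the surplus power of
  \<open>r\<close> is bounded by that of \<open>D\<close>; the constants 8 and 2^N are absorbed
  since 8 <= 2^(\<open>N'\<close> + 1) and 2^N <= 2^\<open>N'\<close>.\<close>

lemma powr_le_max_mult_min:
  fixes r d D N N' :: real
  assumes "0 \<le> r" "r \<le> D" "0 < d" "0 < N" and N': "N' = max 2 N"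
  shows "r powr N' \<le> max (2 powr (N' + 1) * D powr (N' - 2)) (2 powr N' * D powr (N' - N) / d)
    * min (r\<^sup>2 / 8) (d * (r / 2) powr N)" (is "_ \<le> max ?a ?b * min ?u ?w")
proof (cases "r = 0")
  case True
  then show ?thesis using assms by auto
next
  case False
  then have r: "0 < r" using assms by simp
  have u: "r powr N' \<le> ?a * ?u"
  proof -
    have "r powr N' = r powr 2 * r powr (N' - 2)" by (simp flip: powr_add)
    also have "\<dots> \<le> r powr 2 * D powr (N' - 2)"
      using r assms by (intro mult_left_mono powr_mono2) auto
    also have "\<dots> = 8 * D powr (N' - 2) * (r\<^sup>2 / 8)" using r by (simp add: powr_numeral)
    also have "\<dots> \<le> ?a * ?u"
    proof (intro mult_right_mono)
      have "(2::real) powr 3 \<le> 2 powr (N' + 1)" using N' by (intro powr_mono) auto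
      then show "8 \<le> (2::real) powr (N' + 1)" by simp
    qed auto
    finally show ?thesis .
  qed
  have w: "r powr N' \<le> ?b * ?w"
  proof -
    have "r powr N' = r powr N * r powr (N' - N)" by (simp flip: powr_add)
    also have "\<dots> \<le> r powr N * D powr (N' - N)"
      using r assms by (intro mult_left_mono powr_mono2) auto
    also have "\<dots> = 2 powr N * D powr (N' - N) / d * ?w"
      using r \<open>0 < d\<close> by (simp add: powr_divide)
    also have "\<dots> \<le> ?b * ?w"
      using \<open>0 < d\<close> N' by (intro mult_right_mono divide_right_mono powr_mono) auto
    finally show ?thesis .
  qed
  have "?a * ?u \<le> max ?a ?b * ?u" "?b * ?w \<le> max ?a ?b * ?w"
    using \<open>0 < d\<close> by (intro mult_right_mono; simp)+
  then show ?thesis using u w by (auto simp: min_def)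
qed

text \<open>The estimate with slack \<open>\<eta>\<close>; \<open>B\<close> bounds the
  \<open>N'\<close>-th power of the distance to the zero set at time \<open>T\<close>. In
  \<open>B\<close> the term \<open>2 * \<eta>\<close> has two sources, the near-optimality of the
  curve and that of its competitor after \<open>t0\<close>.\<close>

lemma (in torus_potential) value_iteration_le_value_function_add:
  fixes d N N' D L M T \<eta> :: real
  assumes "0 < \<delta>" "0 < d" "0 < N"
    and Loj: "\<And>\<theta>. d * infdist \<theta> (zero_set Q) powr N \<le> Q \<theta>"
    and N': "N' = max 2 N" and D: "D = 2 * pi * sqrt (real CARD('n))" and L: "L = max_gradient Q"
    and M: "M = max (2 powr (N' + 1) * D powr (N' - 2)) (2 powr N' * D powr (N' - N) / d)"
    and T: "T = real i * \<delta>" "0 < T" and "0 < \<eta>"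
  defines "B \<equiv> M * ((D + L) / 2 * (((D + L) / 2 * D + \<eta>) / (d * T)) powr (1 / N) + 2 * \<eta>)"
  shows "value_iteration Q \<delta> i p
    \<le> value_function Q p + \<eta> + (1/2 * (B powr (1 / N'))\<^sup>2 + L / 2 * B powr (1 / N'))"
proof -
  let ?dist = "\<lambda>p. infdist p (zero_set Q)"
  have L0: "0 \<le> L" using max_gradient_nonneg by (simp add: L)
  have D0: "0 < D" by (simp add: D)
  have distD: "?dist p \<le> D" for p using infdist_zero_set_le[of p] by (simp add: D)
  have M0: "0 < M"
  proof -
    have "0 < 2 powr (N' + 1) * D powr (N' - 2)" using D0 by simp
    then show ?thesis by (simp add: M less_max_iff_disj)
  qed
  \<comment> \<open>One factor of the squared distance is replaced by \<open>D\<close>, which makes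
    the initial guess linear in the distance.\<close>
  have V0: "value_iteration Q \<delta> 0 p \<le> (D + L) / 2 * ?dist p" for p
  proof -
    have "?dist p * ?dist p \<le> D * ?dist p" by (intro mult_right_mono distD infdist_nonneg)
    then show ?thesis by (simp add: L power2_eq_square algebra_simps add_divide_distrib)
  qed
  obtain x where x: "torus_of x = p" using torus_of_surj by blast
  have "value_function Q (torus_of x) < value_function Q p + \<eta>" using x \<open>0 < \<eta>\<close> by simp
  then obtain \<phi> v where \<phi>: "\<phi> 0 = x" "cpath \<phi> v (value_function Q p + \<eta>)"
    by (rule value_function_approx)
  have h: "h1_lift \<phi> v" and J: "\<And>S. 0 \<le> S \<Longrightarrow> integral {0..S} (cost \<phi> v) \<le> value_function Q p + \<eta>"
    using \<phi>(2) by (auto simp: finite_cost_path_def)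
  have "value_function Q p \<le> (D + L) / 2 * ?dist p"
    using value_function_le_value_iteration_0 V0 by (rule order_trans)
  also have "\<dots> \<le> (D + L) / 2 * D" using distD L0 D0 by (intro mult_left_mono) auto
  finally have J': "integral {0..T} (cost \<phi> v) \<le> (D + L) / 2 * D + \<eta>" using J[of T] T(2) by simp
  have "continuous_on {0..T} (\<lambda>t. Q (torus_of (\<phi> t)))"
    by (rule continuous_on_subset[OF Q_path_continuous[OF h]]) auto
  \<comment> \<open>The time at which the potential is smallest on \<open>{0..T}\<close>; there it
    is at most the average of the cost.\<close>
  then obtain t0 where t0: "t0 \<in> {0..T}" "\<And>t. t \<in> {0..T} \<Longrightarrow> Q (torus_of (\<phi> t0)) \<le> Q (torus_of (\<phi> t))"
    using continuous_attains_inf[of "{0..T}"] T(2) by (metis atLeastatMost_empty_iff2 compact_Icc less_imp_le not_le)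
  define \<rho> where "\<rho> = ?dist (torus_of (\<phi> t0))"
  have \<rho>: "0 \<le> \<rho>" by (simp add: \<rho>_def infdist_nonneg)
  have "integral {0..T} (\<lambda>_. Q (torus_of (\<phi> t0))) \<le> integral {0..T} (cost \<phi> v)"
  proof (rule integral_le)
    show "(\<lambda>_. Q (torus_of (\<phi> t0))) integrable_on {0..T}" by (rule integrable_const_ivl)
    show "cost \<phi> v integrable_on {0..T}" by (rule cost_integrable[OF h order_refl])
    show "Q (torus_of (\<phi> t0)) \<le> cost \<phi> v t" if "t \<in> {0..T}" for t
      using t0(2)[OF that] by (simp add: path_cost_def add_increasing)
  qed
  then have "T * Q (torus_of (\<phi> t0)) \<le> (D + L) / 2 * D + \<eta>" using J' T(2) by simp
  moreover have "T * (d * \<rho> powr N) \<le> T * Q (torus_of (\<phi> t0))"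
    using Loj T(2) by (simp add: \<rho>_def)
  ultimately have "T * (d * \<rho> powr N) \<le> (D + L) / 2 * D + \<eta>" by (rule order_trans[rotated])
  then have "\<rho> powr N * (d * T) \<le> (D + L) / 2 * D + \<eta>" by (simp only: mult_ac)
  then have "\<rho> powr N \<le> ((D + L) / 2 * D + \<eta>) / (d * T)"
    using \<open>0 < d\<close> T(2) by (subst pos_le_divide_eq) auto
  then have "(\<rho> powr N) powr (1 / N) \<le> (((D + L) / 2 * D + \<eta>) / (d * T)) powr (1 / N)"
    using \<open>0 < N\<close> by (intro powr_mono2) auto
  then have \<rho>_le: "\<rho> \<le> (((D + L) / 2 * D + \<eta>) / (d * T)) powr (1 / N)"
    using \<open>0 < N\<close> \<rho> by (simp add: powr_powr)
  \<comment> \<open>A competitor follows the curve up to \<open>t0\<close> and then a near-optimal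
    continuation. As the curve itself is optimal up to \<open>\<eta>\<close>, its own remaining cost
    cannot exceed that of the continuation by more than \<open>\<eta>\<close>. The horizon is
    \<open>T + 1\<close> so that the unit interval after \<open>T\<close> is included.\<close>
  have tail: "integral {t0..T + 1} (cost \<phi> v) \<le> (D + L) / 2 * \<rho> + 2 * \<eta>"
  proof -
    have "value_function Q (torus_of (\<phi> t0)) \<le> (D + L) / 2 * \<rho>"
      unfolding \<rho>_def using value_function_le_value_iteration_0 V0 by (rule order_trans)
    then have "value_function Q (torus_of (\<phi> t0)) < (D + L) / 2 * \<rho> + \<eta>" using \<open>0 < \<eta>\<close> by simp
    then obtain \<psi> w where \<psi>: "\<psi> 0 = \<phi> t0" "cpath \<psi> w ((D + L) / 2 * \<rho> + \<eta>)"
      by (rule value_function_approx)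
    have "value_function Q p \<le> integral {0..t0} (cost \<phi> v) + ((D + L) / 2 * \<rho> + \<eta>)"
      using value_function_le[OF path_concat[OF h \<psi>(2), of t0]] \<psi>(1) t0(1) \<phi>(1) x by (simp add: concat_at_def)
    moreover have "integral {0..t0} (cost \<phi> v) + integral {t0..T + 1} (cost \<phi> v) \<le> value_function Q p + \<eta>"
      using J[of "T + 1"] cost_integral_combine[OF h order_refl, of t0 "T + 1"] t0(1) T(2) by simp
    ultimately show ?thesis by simp
  qed
  define r where "r = ?dist (torus_of (\<phi> T))"
  have r: "0 \<le> r" by (simp add: r_def infdist_nonneg)
  have "min (r\<^sup>2 / 8) (d * (r / 2) powr N) \<le> integral {T..T + 1} (cost \<phi> v)"
    unfolding r_def using cost_lower_bound[OF h _ \<open>0 < d\<close> \<open>0 < N\<close> Loj, of T] T(2) by simp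
  \<comment> \<open>Since t0 <= T, the interval after \<open>T\<close> is part of the tail, and the
    cost in between is nonnegative.\<close>
  also have "\<dots> \<le> integral {t0..T + 1} (cost \<phi> v)"
    using cost_integral_combine[OF h, of t0 T "T + 1"] cost_integral_nonneg[OF h, of t0 T] t0(1) by simp
  also have "\<dots> \<le> (D + L) / 2 * (((D + L) / 2 * D + \<eta>) / (d * T)) powr (1 / N) + 2 * \<eta>"
  proof -
    have "0 \<le> (D + L) / 2" using L0 D0 by simp
    from mult_left_mono[OF \<rho>_le this] tail show ?thesis by linarith
  qed
  finally have "M * min (r\<^sup>2 / 8) (d * (r / 2) powr N) \<le> B"
    unfolding B_def using M0 by (intro mult_left_mono) auto
  moreover have "r powr N' \<le> M * min (r\<^sup>2 / 8) (d * (r / 2) powr N)"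
    unfolding M using powr_le_max_mult_min[OF r _ \<open>0 < d\<close> \<open>0 < N\<close> N', of D] distD by (simp add: r_def)
  ultimately have "(r powr N') powr (1 / N') \<le> B powr (1 / N')"
    using N' by (intro powr_mono2) auto
  moreover have "N' \<noteq> 0" using N' by simp
  ultimately have "r \<le> B powr (1 / N')" using r by (simp add: powr_powr)
  then have "value_iteration Q \<delta> 0 (torus_of (\<phi> T)) \<le> 1/2 * (B powr (1 / N'))\<^sup>2 + L / 2 * B powr (1 / N')"
    unfolding r_def L by (rule value_iteration_0_mono)
  moreover have "value_iteration Q \<delta> i p \<le> integral {0..T} (cost \<phi> v) + value_iteration Q \<delta> 0 (torus_of (\<phi> T))"
    using value_iteration_le_path[OF \<phi>(2) \<open>0 < \<delta>\<close>, of i] unfolding \<phi>(1) x T(1) .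
  ultimately show ?thesis using J[of T] T(2) by linarith
qed

section \<open>The explicit number of iterations\<close>

theorem proposition7:
  fixes Q :: "'n::finite torus \<Rightarrow> real"
    and \<delta> d N L N' \<sigma>1 \<sigma>2 D :: real
  assumes "torus_real_analytic Q"
    and "\<And>\<theta>. Q \<theta> \<ge> 0"
    and "zero_set Q \<noteq> {}"
    and "\<delta> > 0"
    and "L = max_gradient Q"
    and "d > 0" and "N > 0"
    and "\<And>\<theta>. \<bar>Q \<theta>\<bar> \<ge> d * infdist \<theta> (zero_set Q) powr N"
    and "N' = max 2 N"
    and "D = 2 * pi * sqrt (real CARD('n))"
    and "\<sigma>1 = (D + L) / 2 *
           max (2 powr (N' + 1) * D powr (N' - 2)) (2 powr N' * D powr (N' - N) / d)"
    and "\<sigma>2 = (D + L) * \<sigma>1 powr N / (2 * d)"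
  shows "\<forall>\<epsilon>>0. \<forall>i::nat.
    real i > D * \<sigma>2 / (\<delta> * ((- L + sqrt (L\<^sup>2 + 8 * \<epsilon>)) / 2) powr (N' * N)) \<longrightarrow>
    (\<forall>\<theta>. \<bar>value_iteration Q \<delta> i \<theta> - value_function Q \<theta>\<bar> < \<epsilon>)"
proof (intro allI impI)
  fix \<epsilon> :: real and i :: nat and \<theta>
  assume "0 < \<epsilon>" and i: "D * \<sigma>2 / (\<delta> * ((- L + sqrt (L\<^sup>2 + 8 * \<epsilon>)) / 2) powr (N' * N)) < real i"
  interpret torus_potential Q
    by unfold_locales (rule assms torus_real_analytic_Lipschitz[OF assms(1)])+
  have Loj: "d * infdist \<theta> (zero_set Q) powr N \<le> Q \<theta>" for \<theta>
    using assms(8)[of \<theta>] assms(2)[of \<theta>] by simp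
  have L0: "0 \<le> L" using max_gradient_nonneg assms(5) by simp
  have D0: "0 < D" by (simp add: assms(10))
  \<comment> \<open>The positive root of e^2/2 + L e/2 = \<open>\<epsilon>\<close>: the initial
    guess at distance \<open>e\<close> from the zero set equals the tolerance.\<close>
  define e where "e = (- L + sqrt (L\<^sup>2 + 8 * \<epsilon>)) / 2"
  have "sqrt (L\<^sup>2) < sqrt (L\<^sup>2 + 8 * \<epsilon>)" using \<open>0 < \<epsilon>\<close> by (intro real_sqrt_less_mono) simp
  then have e0: "0 < e" using L0 by (simp add: e_def)
  have "2 * e + L = sqrt (L\<^sup>2 + 8 * \<epsilon>)" by (simp add: e_def field_simps)
  then have "(2 * e + L)\<^sup>2 = L\<^sup>2 + 8 * \<epsilon>" using \<open>0 < \<epsilon>\<close> by simp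
  then have he: "1/2 * e\<^sup>2 + L / 2 * e = \<epsilon>" by (simp add: power2_eq_square algebra_simps)
  define M where "M = max (2 powr (N' + 1) * D powr (N' - 2)) (2 powr N' * D powr (N' - N) / d)"
  have M0: "0 < M"
  proof -
    have "0 < 2 powr (N' + 1) * D powr (N' - 2)" using D0 by simp
    then show ?thesis by (simp add: M_def less_max_iff_disj)
  qed
  have \<sigma>1: "\<sigma>1 = (D + L) / 2 * M" using assms(11) by (simp add: M_def)
  have \<sigma>1_pos: "0 < \<sigma>1" using M0 D0 L0 by (simp add: \<sigma>1)
  have \<sigma>2_pos: "0 < \<sigma>2" using \<sigma>1_pos D0 L0 \<open>0 < d\<close> by (simp add: assms(12))
  define T where "T = real i * \<delta>"
  have T: "D * \<sigma>2 < T * e powr (N' * N)"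
    using i[folded e_def] \<open>0 < \<delta>\<close> e0 by (simp add: T_def pos_divide_less_eq mult_ac)
  \<comment> \<open>Positivity of the horizon, in particular i > 0, is forced by the lower bound on
    \<open>i\<close>, whose left side is positive.\<close>
  have "0 < T * e powr (N' * N)" using T D0 \<sigma>2_pos by (meson less_trans mult_pos_pos)
  then have T0: "0 < T" using e0 by (simp add: zero_less_mult_iff)
  define B where "B \<eta> = M * ((D + L) / 2 * (((D + L) / 2 * D + \<eta>) / (d * T)) powr (1 / N) + 2 * \<eta>)" for \<eta>
  have N'0: "0 < N'" using assms(9) by simp
  define K where "K = (D + L) / 2 * D / (d * T)"
  have K0: "0 < K" using D0 L0 \<open>0 < d\<close> T0 by (simp add: K_def)
  have B0: "B 0 = \<sigma>1 * K powr (1 / N)" by (simp add: B_def \<sigma>1 K_def)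
  have B0_pos: "0 < B 0" using \<sigma>1_pos K0 by (simp add: B0)
  \<comment> \<open>The N-th power removes the root in \<open>B 0\<close> and leaves exactly D
    \<open>\<sigma>2\<close> / T, which is how \<open>\<sigma>2\<close> arises; the condition on
    \<open>i\<close> compares it with \<open>e powr (N' * N)\<close>.\<close>
  have B0_lt: "B 0 powr (1 / N') < e"
  proof -
    have "B 0 powr N = \<sigma>1 powr N * K"
      using \<sigma>1_pos K0 \<open>0 < N\<close> by (simp add: B0 powr_mult powr_powr)
    also have "\<dots> = D * \<sigma>2 / T"
      using \<open>0 < d\<close> T0 by (simp add: K_def assms(12) field_simps)
    also have "\<dots> < e powr (N' * N)" using T T0 by (simp add: pos_divide_less_eq mult_ac)
    finally have "(B 0 powr N) powr (1 / (N' * N)) < (e powr (N' * N)) powr (1 / (N' * N))"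
      using \<open>0 < N\<close> N'0 by (intro powr_less_mono2) auto
    then show ?thesis using \<open>0 < N\<close> N'0 e0 by (simp add: powr_powr)
  qed
  let ?h = "\<lambda>\<rho>. 1/2 * \<rho>\<^sup>2 + L / 2 * \<rho>"
  \<comment> \<open>The slack tends to 0 from the right. The limit preserves only a weak inequality;
    the strict one follows afterwards from \<open>B0_lt\<close>.\<close>
  have "value_iteration Q \<delta> i \<theta> \<le> value_function Q \<theta> + 0 + ?h (B 0 powr (1 / N'))"
  proof (rule tendsto_lowerbound)
    \<comment> \<open>Continuity of the real power at \<open>\<eta> = 0\<close> rests on its base
      \<open>K\<close> being positive there.\<close>
    have "isCont B 0" unfolding B_def using K0 \<open>0 < d\<close> T0
      by (intro continuous_intros) (auto simp: K_def)
    then have "(B \<longlongrightarrow> B 0) (at_right 0)" by (simp add: isCont_def filterlim_at_split)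
    then show "((\<lambda>\<eta>. value_function Q \<theta> + \<eta> + ?h (B \<eta> powr (1 / N')))
        \<longlongrightarrow> value_function Q \<theta> + 0 + ?h (B 0 powr (1 / N'))) (at_right 0)"
      using B0_pos by (intro tendsto_intros) auto
    show "\<forall>\<^sub>F \<eta> in at_right 0. value_iteration Q \<delta> i \<theta> \<le> value_function Q \<theta> + \<eta> + ?h (B \<eta> powr (1 / N'))"
      using eventually_at_right_less[of 0]
    proof eventually_elim
      case (elim \<eta>)
      show ?case
        unfolding B_def
        by (rule value_iteration_le_value_function_add[OF \<open>0 < \<delta>\<close> \<open>0 < d\<close> \<open>0 < N\<close> Loj assms(9,10,5) M_def T_def T0 elim])
    qed
  qed simp
  also have "\<dots> < value_function Q \<theta> + 0 + ?h e"
  proof -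
    have "(B 0 powr (1 / N'))\<^sup>2 < e\<^sup>2" using B0_lt by (intro power_strict_mono) auto
    moreover have "L / 2 * B 0 powr (1 / N') \<le> L / 2 * e" using B0_lt L0 by (intro mult_left_mono) auto
    ultimately show ?thesis by simp
  qed
  finally have "value_iteration Q \<delta> i \<theta> < value_function Q \<theta> + \<epsilon>" using he by simp
  then show "\<bar>value_iteration Q \<delta> i \<theta> - value_function Q \<theta>\<bar> < \<epsilon>"
    using value_function_le_value_iteration[OF \<open>0 < \<delta>\<close>, of \<theta> i] by simp
qed

end
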